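(* The joint transportation and charging scheduling (JTCS) algorithm always converges, in each time slot $t$, to the normalized Nash equilibrium (NNE) of the joint transportation and charging scheduling problem (JTCSP), since the Solodov–Svaiter projection method (SSPM) used in it always converges to the optimal solution of the variational inequality problem $\mathrm{VI}(\mathbf{F}_t,\Omega_t)$, where $\mathbf{F}_t:=-(\nabla_{x_{i,t}}u_{i,t})_{i\in\mathcal{I}}$ is continuous and monotonic, and the solution to $\mathrm{VI}(\mathbf{F}_t,\Omega_t)$ is the NNE with identical weights.
   Context: JTCSP in time slot $t$: the players are the public vehicle groups (PVGs) $i\in\mathcal{I}=\{1,\dots,I\}$, one per region of a city. PVG $i$ consists of the $m_{i,t}$ not fully charged vehicles in region $i$ and chooses the fraction $x_{i,t}$ of them used for transportation (the rest charge), in order to maximize $$u_{i,t}=-(m_{i,t}x_{i,t}-d_{i,t})^2+\alpha_1 m_{i,t}\ln(2-x_{i,t})-\alpha_2\,p_t\,m_{i,t}(1-x_{i,t})$$ subject to $r\sum_{j\in\mathcal{I}}m_{j,t}(1-x_{j,t})=E^+_t$, $\sum_{j\in\mathcal{I}}m_{j,t}x_{j,t}\ge d_t$, and $x_{j,t}\in[0,1]$ for all $j\in\mathcal{I}$. Here $d_{i,t}$ is the transportation demand of PVG $i$, $d_t=\sum_i d_{i,t}$, $r$ is the energy charged by a vehicle in one slot, $E^+_t$ is the total charging demand, $\alpha_1,\alpha_2$ are constants, and $p_t$ is the real-time electricity price, modelled as $p_t=\alpha_0(L_t/C_0)^{k_0}$ with $L_t$ the total electricity load, $C_0$ the market capacity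 and $\alpha_0,k_0$ constants, and assumed known in advance. $\Omega_{i,t}$ is the feasible strategy set of PVG $i$ (its strategies satisfying the three constraints), and $\Omega_t:=\Omega_{1,t}\times\dots\times\Omega_{I,t}$. The three sets of constraints are collected as $\boldsymbol{\theta}(\mathbf{x}_t)\le 0$, and $\mathrm{VI}(\mathbf{F}_t,\Omega_t)$ is considered with the constraint $\boldsymbol{\theta}(\mathbf{x}_t)\le0$. NNE with identical weights $w_{1,t}=\dots=w_{I,t}=1$: a point $\mathbf{x}_t\in\Omega_t$ for which there is a multiplier vector $\bar{\boldsymbol{\lambda}}_t$, common to all players, such that for all $i\in\mathcal{I}$: $-\nabla_{x_{i,t}}u_{i,t}+\bar{\boldsymbol{\lambda}}_t^T\nabla_{x_{i,t}}\boldsymbol{\theta}(\mathbf{x}_t)=0$, $\bar{\boldsymbol{\lambda}}_t^T\boldsymbol{\theta}(\mathbf{x}_t)=0$, $\bar{\boldsymbol{\lambda}}_t\ge0$, $\boldsymbol{\theta}(\mathbf{x}_t)\le0$. $\mathrm{VI}(F,\Omega)$: find $x^*\in\Omega$ with $\langle F(x^* ),x-x^*\rangle\ge0$ for all $x\in\Omega$, where $\Omega$ is closed and convex and $F$ is continuous. JTCS algorithm. (a) One day ahead, with $T$ time slots $0,\dots,T-1$, all $J$ vehicles are simulated with infinite energy, using a ride-matching heuristic called PCI (requests are processed in order of decreasing waiting time; each is inserted in the vehicle path with minimum insertion cost, i.e. total travel distance, within a limited detour ratio, or else put on a waiting list). The consumed energy $E^-_t$ per slot is recorded, and $\{E^+_t\}$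 is computed as a solution of: minimize $\sum_t p_tE^+_t$ subject to $E^{\mathrm r}_{t+1}=E^{\mathrm r}_t-E^-_t+E^+_t$ for $0\le t\le T-2$; $E^{\mathrm r}_t\ge(1+\rho)\max(E^-_t,Je^{\min})$ for $1\le t\le T-1$; $E^{\mathrm r}_{T-1}-E^-_{T-1}+E^+_{T-1}\ge E^{\mathrm r}_0$; $0\le E^+_t\le(J-d_t)r$; $0\le E^{\mathrm r}_t\le Jc$. Here $E^{\mathrm r}_t$ is the total remaining energy, $c$ the battery capacity, $\rho>0$ a constant, and $e^{\min}$ the minimum energy needed to reach the nearest charging station. (b) In each slot $t$, the PVGs are updated with $m_{i,t}=a_{i,t}-f_{i,t}$ ($a_{i,t}$ all vehicles and $f_{i,t}$ fully or nearly fully charged vehicles in region $i$). PCI is simulated for the slot to obtain the number $n_{i,t}$ of transportation vehicles in region $i$, and $d_{i,t}=\max(n_{i,t}-f_{i,t},0)$, $d_t=\sum_i d_{i,t}$. (c) SSPM is run to obtain the best response strategies $\mathbf{x}^*_t=(x^*_{1,t},\dots,x^*_{I,t})$. Then PVG $i$ uses $\phi_{i,t}=\lceil m_{i,t}x^*_{i,t}\rceil$ vehicles (those with the most remaining energy) for transportation and the remaining $m_{i,t}-\phi_{i,t}$ charge. SSPM: let $P_C(\mathbf{x})=\arg\min_{\mathbf{x}'\in C}\|\mathbf{x}'-\mathbf{x}\|$. Initialize $\mathbf{x}^{(0)}_t\in\Omega_t$, $\eta^{(-1)}>0$, $\gamma_1,\gamma_2\in(0,1)$, $\gamma_3>1$,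 $k=0$, and a small bound $\epsilon>0$. Repeat: set $\mu^{(k)}=\min(\gamma_3\eta^{(k-1)},1)$ and $\nu^{(k)}=\mathbf{x}^{(k)}_t-P_{\Omega_t}\big(\mathbf{x}^{(k)}_t-\mu^{(k)}\mathbf{F}_t(\mathbf{x}^{(k)}_t)\big)$. If $\|\nu^{(k)}\|<\epsilon$, stop and return the current $\mathbf{x}_t$. Otherwise let $\zeta^{(k)}$ be the smallest nonnegative integer with $\langle\mathbf{F}_t(\mathbf{x}^{(k)}_t-\gamma_1^{\zeta^{(k)}}\mu^{(k)}\nu^{(k)}),\nu^{(k)}\rangle\ge\frac{\gamma_2}{\mu^{(k)}}\|\nu^{(k)}\|^2$; set $\eta^{(k)}=\gamma_1^{\zeta^{(k)}}\mu^{(k)}$, $\mathbf{y}^{(k)}=\mathbf{x}^{(k)}_t-\eta^{(k)}\nu^{(k)}$, $\mathbb{H}^{(k)}=\{\mathbf{x}\in\mathbb{R}^I:\langle\mathbf{F}_t(\mathbf{y}^{(k)}),\mathbf{x}-\mathbf{y}^{(k)}\rangle\le0\}$, $\mathbf{x}^{(k+1)}_t=P_{\Omega_t\cap\mathbb{H}^{(k)}}(\mathbf{x}^{(k)}_t)$, and $k\leftarrow k+1$.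
   Formalization: The constant α₁ in the utility is assumed nonnegative; for sufficiently negative α₁ (e.g. α₁ < −4 with two regions of one vehicle each) F_t is not monotonic. *)

theory Defs
  imports "HOL-Analysis.Analysis"
begin

section \<open>Variational inequalities and normalized Nash equilibria\<close>

definition vec_upd :: "real ^ 'i \<Rightarrow> 'i \<Rightarrow> real \<Rightarrow> real ^ 'i" where
  "vec_upd x i s = (\<chi> j. if j = i then s else x $ j)"

definition partial_deriv :: "'i \<Rightarrow> (real ^ 'i \<Rightarrow> real) \<Rightarrow> real ^ 'i \<Rightarrow> real" where
  "partial_deriv i g x = deriv (\<lambda>s. g (vec_upd x i s)) (x $ i)"

definition monotone_operator_on :: "'a::real_inner set \<Rightarrow> ('a \<Rightarrow> 'a) \<Rightarrow> bool" where
  "monotone_operator_on \<Omega> F \<longleftrightarrow> (\<forall>x\<in>\<Omega>. \<forall>y\<in>\<Omega>. (F x - F y) \<bullet> (x - y) \<ge> 0)"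

definition VI_solution :: "('a::real_inner \<Rightarrow> 'a) \<Rightarrow> 'a set \<Rightarrow> 'a \<Rightarrow> bool" where
  "VI_solution F \<Omega> x \<longleftrightarrow> x \<in> \<Omega> \<and> (\<forall>y\<in>\<Omega>. F x \<bullet> (y - x) \<ge> 0)"

text \<open>
  Normalized Nash equilibrium with identical weights: utilities \<open>u\<close>, jointly feasible set \<open>\<Omega>\<close>,
  shared constraints \<open>\<theta> c x \<le> 0\<close>. The multiplier vector \<open>\<mu>\<close> does not depend on the player.
\<close>

definition normalized_Nash ::
    "('i \<Rightarrow> real ^ 'i \<Rightarrow> real) \<Rightarrow> ('c::finite \<Rightarrow> real ^ 'i \<Rightarrow> real) \<Rightarrow> (real ^ 'i) set \<Rightarrow> real ^ 'i \<Rightarrow> bool"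
  where
  "normalized_Nash u \<theta> \<Omega> x \<longleftrightarrow> x \<in> \<Omega> \<and>
     (\<exists>\<mu> :: 'c \<Rightarrow> real.
        (\<forall>i. - partial_deriv i (u i) x + (\<Sum>c\<in>UNIV. \<mu> c * partial_deriv i (\<theta> c) x) = 0) \<and>
        (\<Sum>c\<in>UNIV. \<mu> c * \<theta> c x) = 0 \<and>
        (\<forall>c. \<mu> c \<ge> 0) \<and>
        (\<forall>c. \<theta> c x \<le> 0))"


section \<open>The Solodov--Svaiter projection method\<close>

record sspm_params =
  eta_init :: real   \<comment> \<open>\<open>\<eta>\<^sup>(\<^sup>-\<^sup>1\<^sup>)\<close>\<close>
  gamma1 :: real
  gamma2 :: real
  gamma3 :: real

definition sspm_params_ok :: "sspm_params \<Rightarrow> bool" where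
  "sspm_params_ok P \<longleftrightarrow> eta_init P > 0 \<and> 0 < gamma1 P \<and> gamma1 P < 1 \<and>
     0 < gamma2 P \<and> gamma2 P < 1 \<and> gamma3 P > 1"

text \<open>
  In the one-step functions below \<open>\<eta>\<close> is the step size of the previous iteration.
\<close>

definition step_mu :: "sspm_params \<Rightarrow> real \<Rightarrow> real" where
  "step_mu P \<eta> = min (gamma3 P * \<eta>) 1"

definition step_nu ::
    "sspm_params \<Rightarrow> ('a::euclidean_space \<Rightarrow> 'a) \<Rightarrow> 'a set \<Rightarrow> 'a \<Rightarrow> real \<Rightarrow> 'a" where
  "step_nu P F \<Omega> x \<eta> = x - closest_point \<Omega> (x - step_mu P \<eta> *\<^sub>R F x)"

definition line_search_ok ::
    "sspm_params \<Rightarrow> ('a::euclidean_space \<Rightarrow> 'a) \<Rightarrow> 'a set \<Rightarrow> 'a \<Rightarrow> real \<Rightarrow> nat \<Rightarrow> bool" where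
  "line_search_ok P F \<Omega> x \<eta> \<zeta> \<longleftrightarrow>
     F (x - (gamma1 P ^ \<zeta> * step_mu P \<eta>) *\<^sub>R step_nu P F \<Omega> x \<eta>) \<bullet> step_nu P F \<Omega> x \<eta>
       \<ge> gamma2 P / step_mu P \<eta> * (norm (step_nu P F \<Omega> x \<eta>))\<^sup>2"

definition step_eta ::
    "sspm_params \<Rightarrow> ('a::euclidean_space \<Rightarrow> 'a) \<Rightarrow> 'a set \<Rightarrow> 'a \<Rightarrow> real \<Rightarrow> real" where
  "step_eta P F \<Omega> x \<eta> = gamma1 P ^ (LEAST \<zeta>. line_search_ok P F \<Omega> x \<eta> \<zeta>) * step_mu P \<eta>"

definition step_halfspace ::
    "sspm_params \<Rightarrow> ('a::euclidean_space \<Rightarrow> 'a) \<Rightarrow> 'a set \<Rightarrow> 'a \<Rightarrow> real \<Rightarrow> 'a set" where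
  "step_halfspace P F \<Omega> x \<eta> =
     (let y = x - step_eta P F \<Omega> x \<eta> *\<^sub>R step_nu P F \<Omega> x \<eta> in {z. F y \<bullet> (z - y) \<le> 0})"

text \<open>
  The loop is iterated here without its stopping test, which only selects the index at which the
  sequence is read off (\<open>sspm_output\<close>). The pair at index \<open>k\<close> is
  \<open>(x\<^sup>(\<^sup>k\<^sup>), \<eta>\<^sup>(\<^sup>k\<^sup>-\<^sup>1\<^sup>))\<close>.
\<close>

primrec sspm_state ::
    "sspm_params \<Rightarrow> ('a::euclidean_space \<Rightarrow> 'a) \<Rightarrow> 'a set \<Rightarrow> 'a \<Rightarrow> nat \<Rightarrow> 'a \<times> real" where
  "sspm_state P F \<Omega> x0 0 = (x0, eta_init P)"
| "sspm_state P F \<Omega> x0 (Suc k) =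
     (let (x, \<eta>) = sspm_state P F \<Omega> x0 k
      in (closest_point (\<Omega> \<inter> step_halfspace P F \<Omega> x \<eta>) x, step_eta P F \<Omega> x \<eta>))"

definition sspm_iterate ::
    "sspm_params \<Rightarrow> ('a::euclidean_space \<Rightarrow> 'a) \<Rightarrow> 'a set \<Rightarrow> 'a \<Rightarrow> nat \<Rightarrow> 'a" where
  "sspm_iterate P F \<Omega> x0 k = fst (sspm_state P F \<Omega> x0 k)"

definition sspm_residual ::
    "sspm_params \<Rightarrow> ('a::euclidean_space \<Rightarrow> 'a) \<Rightarrow> 'a set \<Rightarrow> 'a \<Rightarrow> nat \<Rightarrow> 'a" where
  "sspm_residual P F \<Omega> x0 k = (case sspm_state P F \<Omega> x0 k of (x, \<eta>) \<Rightarrow> step_nu P F \<Omega> x \<eta>)"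

definition sspm_stops_at ::
    "sspm_params \<Rightarrow> ('a::euclidean_space \<Rightarrow> 'a) \<Rightarrow> 'a set \<Rightarrow> 'a \<Rightarrow> real \<Rightarrow> nat \<Rightarrow> bool" where
  "sspm_stops_at P F \<Omega> x0 \<epsilon> k \<longleftrightarrow> norm (sspm_residual P F \<Omega> x0 k) < \<epsilon>"

definition sspm_output ::
    "sspm_params \<Rightarrow> ('a::euclidean_space \<Rightarrow> 'a) \<Rightarrow> 'a set \<Rightarrow> 'a \<Rightarrow> real \<Rightarrow> 'a" where
  "sspm_output P F \<Omega> x0 \<epsilon> = sspm_iterate P F \<Omega> x0 (LEAST k. sspm_stops_at P F \<Omega> x0 \<epsilon> k)"

text \<open>
  Every step is executable: the line search finds an exponent, and the set projected onto is
  nonempty. (Otherwise \<^const>\<open>Least\<close> and \<^const>\<open>closest_point\<close> would be unspecified.)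
\<close>

definition sspm_well_defined ::
    "sspm_params \<Rightarrow> ('a::euclidean_space \<Rightarrow> 'a) \<Rightarrow> 'a set \<Rightarrow> 'a \<Rightarrow> bool" where
  "sspm_well_defined P F \<Omega> x0 \<longleftrightarrow>
     (\<forall>k. case sspm_state P F \<Omega> x0 k of (x, \<eta>) \<Rightarrow>
        (\<exists>\<zeta>. line_search_ok P F \<Omega> x \<eta> \<zeta>) \<and> \<Omega> \<inter> step_halfspace P F \<Omega> x \<eta> \<noteq> {})"


section \<open>Joint transportation and charging scheduling\<close>

text \<open>
  All data of one execution of the JTCS algorithm. Regions (players) are the elements of the
  finite type \<open>'i\<close>. The quantities obtained by simulating the ride-matching heuristic (\<open>E_minus\<close>,
  \<open>d_ahead\<close>, \<open>n_trans\<close>) and by observing the fleet (\<open>a_all\<close>, \<open>f_full\<close>) are unrestricted inputs.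
\<close>

record jtcs_constants =
  T_slots :: nat
  J_veh :: nat
  r_charge :: real
  c_batt :: real
  rho :: real
  e_min :: real
  alpha0 :: real
  alpha1 :: real
  alpha2 :: real
  k0 :: real
  C0 :: real
  L_load :: "nat \<Rightarrow> real"

record jtcs_day_ahead = jtcs_constants +
  E_minus :: "nat \<Rightarrow> real"
  d_ahead :: "nat \<Rightarrow> real"
  E_plus :: "nat \<Rightarrow> real"
  E_rem :: "nat \<Rightarrow> real"

record ('i::finite) jtcs_fleet = jtcs_day_ahead +
  a_all :: "nat \<Rightarrow> 'i \<Rightarrow> nat"
  f_full :: "nat \<Rightarrow> 'i \<Rightarrow> nat"
  n_trans :: "nat \<Rightarrow> 'i \<Rightarrow> nat"

record ('i::finite) jtcs = "'i jtcs_fleet" +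
  sspm :: sspm_params
  eps :: real
  x_init :: "nat \<Rightarrow> real ^ 'i"
  phi :: "nat \<Rightarrow> 'i \<Rightarrow> int"

definition price :: "('i::finite) jtcs \<Rightarrow> nat \<Rightarrow> real" where
  "price S t = alpha0 S * (L_load S t / C0 S) powr k0 S"

definition m_veh :: "('i::finite) jtcs \<Rightarrow> nat \<Rightarrow> 'i \<Rightarrow> real" where
  "m_veh S t i = real (a_all S t i) - real (f_full S t i)"

definition d_dem :: "('i::finite) jtcs \<Rightarrow> nat \<Rightarrow> 'i \<Rightarrow> real" where
  "d_dem S t i = max (real (n_trans S t i) - real (f_full S t i)) 0"

definition d_tot :: "('i::finite) jtcs \<Rightarrow> nat \<Rightarrow> real" where
  "d_tot S t = (\<Sum>i\<in>UNIV. d_dem S t i)"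

definition utility :: "('i::finite) jtcs \<Rightarrow> nat \<Rightarrow> 'i \<Rightarrow> real ^ 'i \<Rightarrow> real" where
  "utility S t i x = - (m_veh S t i * x $ i - d_dem S t i)\<^sup>2
     + alpha1 S * m_veh S t i * ln (2 - x $ i)
     - alpha2 S * price S t * m_veh S t i * (1 - x $ i)"

definition charged_energy :: "('i::finite) jtcs \<Rightarrow> nat \<Rightarrow> real ^ 'i \<Rightarrow> real" where
  "charged_energy S t x = r_charge S * (\<Sum>j\<in>UNIV. m_veh S t j * (1 - x $ j))"

definition served_demand :: "('i::finite) jtcs \<Rightarrow> nat \<Rightarrow> real ^ 'i \<Rightarrow> real" where
  "served_demand S t x = (\<Sum>j\<in>UNIV. m_veh S t j * x $ j)"

definition jointly_feasible :: "('i::finite) jtcs \<Rightarrow> nat \<Rightarrow> real ^ 'i \<Rightarrow> bool" where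
  "jointly_feasible S t x \<longleftrightarrow> charged_energy S t x = E_plus S t \<and>
     served_demand S t x \<ge> d_tot S t \<and> (\<forall>j. x $ j \<in> {0..1})"

text \<open>
  The constraints couple the players, so player \<open>i\<close>'s strategy set depends on the strategies of the
  others, and the "product" of the strategy sets consists of the profiles in which every player's
  strategy is feasible given the rest, as is usual for generalized Nash games.
\<close>

definition strategy_set :: "('i::finite) jtcs \<Rightarrow> nat \<Rightarrow> 'i \<Rightarrow> real ^ 'i \<Rightarrow> real set" where
  "strategy_set S t i x = {s. jointly_feasible S t (vec_upd x i s)}"

definition Omega :: "('i::finite) jtcs \<Rightarrow> nat \<Rightarrow> (real ^ 'i) set" where
  "Omega S t = {x. \<forall>i. x $ i \<in> strategy_set S t i x}"

text \<open>
  Index type of the inequality system \<open>\<theta>(x) \<le> 0\<close>; the charging equation is split in two.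
\<close>

datatype 'i cstr = Charge_le | Charge_ge | Demand | Upper 'i | Lower 'i

instance cstr :: (finite) finite
proof
  have "x \<in> {Charge_le, Charge_ge, Demand} \<union> range Upper \<union> range Lower" for x :: "'a cstr"
    by (cases x) simp_all
  then have "(UNIV :: 'a cstr set) \<subseteq> {Charge_le, Charge_ge, Demand} \<union> range Upper \<union> range Lower"
    by blast
  then show "finite (UNIV :: 'a cstr set)"
    by (rule finite_subset) simp
qed

fun theta :: "('i::finite) jtcs \<Rightarrow> nat \<Rightarrow> 'i cstr \<Rightarrow> real ^ 'i \<Rightarrow> real" where
  "theta S t Charge_le x = charged_energy S t x - E_plus S t"
| "theta S t Charge_ge x = E_plus S t - charged_energy S t x"
| "theta S t Demand x = d_tot S t - served_demand S t x"
| "theta S t (Upper j) x = x $ j - 1"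
| "theta S t (Lower j) x = - (x $ j)"

definition F_map :: "('i::finite) jtcs \<Rightarrow> nat \<Rightarrow> real ^ 'i \<Rightarrow> real ^ 'i" where
  "F_map S t x = (\<chi> i. - partial_deriv i (utility S t i) x)"

abbreviation is_NNE :: "('i::finite) jtcs \<Rightarrow> nat \<Rightarrow> real ^ 'i \<Rightarrow> bool" where
  "is_NNE S t \<equiv> normalized_Nash (utility S t) (theta S t) (Omega S t)"

abbreviation jtcs_iterate :: "('i::finite) jtcs \<Rightarrow> nat \<Rightarrow> nat \<Rightarrow> real ^ 'i" where
  "jtcs_iterate S t \<equiv> sspm_iterate (sspm S) (F_map S t) (Omega S t) (x_init S t)"

abbreviation jtcs_stops_at :: "('i::finite) jtcs \<Rightarrow> nat \<Rightarrow> real \<Rightarrow> nat \<Rightarrow> bool" where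
  "jtcs_stops_at S t \<equiv> sspm_stops_at (sspm S) (F_map S t) (Omega S t) (x_init S t)"

abbreviation jtcs_strategy :: "('i::finite) jtcs \<Rightarrow> nat \<Rightarrow> real \<Rightarrow> real ^ 'i" where
  "jtcs_strategy S t \<equiv> sspm_output (sspm S) (F_map S t) (Omega S t) (x_init S t)"

definition plan_feasible :: "('i::finite) jtcs \<Rightarrow> (nat \<Rightarrow> real) \<Rightarrow> (nat \<Rightarrow> real) \<Rightarrow> bool" where
  "plan_feasible S Ep Er \<longleftrightarrow>
     (\<forall>t. t + 1 < T_slots S \<longrightarrow> Er (t + 1) = Er t - E_minus S t + Ep t) \<and>
     (\<forall>t. 1 \<le> t \<and> t < T_slots S \<longrightarrow>
        Er t \<ge> (1 + rho S) * max (E_minus S t) (real (J_veh S) * e_min S)) \<and>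
     Er (T_slots S - 1) - E_minus S (T_slots S - 1) + Ep (T_slots S - 1) \<ge> Er 0 \<and>
     (\<forall>t < T_slots S. 0 \<le> Ep t \<and> Ep t \<le> (real (J_veh S) - d_ahead S t) * r_charge S) \<and>
     (\<forall>t < T_slots S. 0 \<le> Er t \<and> Er t \<le> real (J_veh S) * c_batt S)"

text \<open>
  The initial energy \<open>E_rem S 0\<close> is treated as given. A plan that is optimal also over the initial
  energy is in particular optimal in this sense.
\<close>

definition plan_optimal :: "('i::finite) jtcs \<Rightarrow> bool" where
  "plan_optimal S \<longleftrightarrow> plan_feasible S (E_plus S) (E_rem S) \<and>
     (\<forall>Ep Er. plan_feasible S Ep Er \<and> Er 0 = E_rem S 0 \<longrightarrow>
        (\<Sum>t<T_slots S. price S t * E_plus S t) \<le> (\<Sum>t<T_slots S. price S t * Ep t))"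

definition jtcs_run :: "('i::finite) jtcs \<Rightarrow> bool" where
  "jtcs_run S \<longleftrightarrow>
     0 < T_slots S \<and> rho S > 0 \<and> alpha1 S \<ge> 0 \<and> C0 S > 0 \<and> (\<forall>t < T_slots S. L_load S t > 0) \<and>
     plan_optimal S \<and>
     (\<forall>t < T_slots S. \<forall>i. f_full S t i \<le> a_all S t i) \<and>
     sspm_params_ok (sspm S) \<and> eps S > 0 \<and>
     (\<forall>t < T_slots S. x_init S t \<in> Omega S t) \<and>
     (\<forall>t < T_slots S. \<forall>i. phi S t i = \<lceil>m_veh S t i * jtcs_strategy S t (eps S) $ i\<rceil>)"

end

(*
  The joint feasible set is a polytope on which F is continuous and monotone, so Brouwer's theorem
  gives a solution of VI(F, Omega). Every solution lies in all the half-spaces cut off by the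
  projection method; hence the iterates are Fejer monotone, successive differences vanish, and so
  does eta_k times the natural residual. Either eta_k does not vanish, or uniform continuity of F
  bounds the residual at the infinitely many rejected trial steps; in both cases some accumulation
  point solves the VI, and Fejer monotonicity upgrades this to convergence of the whole sequence.
  The constraints are affine, so a normalized equilibrium solves the VI by linear duality; conversely
  an exchange argument between two players yields the common multiplier of the coupling constraints.
*)
theory Submission
  imports Defs
begin

section \<open>Convergence of the projection method\<close>

declare sspm_state.simps(2) [simp del]

text \<open>The natural residual of the VI. Its step is an explicit argument because the method
  changes the step in every iteration, while the convergence argument measures all iterates with
  step 1.\<close>

definition projection_residual :: "('a::euclidean_space \<Rightarrow> 'a) \<Rightarrow> 'a set \<Rightarrow> real \<Rightarrow> 'a \<Rightarrow> 'a" where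
  "projection_residual F \<Omega> \<mu> x = x - closest_point \<Omega> (x - \<mu> *\<^sub>R F x)"

locale monotone_VI =
  fixes F :: "'a::euclidean_space \<Rightarrow> 'a" and \<Omega> :: "'a set"
  assumes compact: "compact \<Omega>" and convex: "convex \<Omega>" and nonempty: "\<Omega> \<noteq> {}"
    and cont: "continuous_on \<Omega> F" and mono: "monotone_operator_on \<Omega> F"
begin

abbreviation \<rho> :: "real \<Rightarrow> 'a \<Rightarrow> 'a" where "\<rho> \<equiv> projection_residual F \<Omega>"

lemma closed: "closed \<Omega>"
  using compact by (rule compact_imp_closed)

text \<open>Obtuse-angle characterization of the projection, written at the projected point
  \<open>x - \<rho> \<mu> x\<close>.\<close>

lemma residual_variational:
  assumes "z \<in> \<Omega>"
  shows "(\<rho> \<mu> x - \<mu> *\<^sub>R F x) \<bullet> (z - x + \<rho> \<mu> x) \<le> 0"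
  using closest_point_dot[OF convex closed assms, of "x - \<mu> *\<^sub>R F x"]
  by (simp add: projection_residual_def algebra_simps)

lemma segment_to_projection:
  assumes "x \<in> \<Omega>" "0 \<le> s" "s \<le> 1"
  shows "x - s *\<^sub>R \<rho> \<mu> x \<in> \<Omega>"
proof -
  have "closest_point \<Omega> (x - \<mu> *\<^sub>R F x) \<in> \<Omega>"
    using closed nonempty by (rule closest_point_in_set)
  then have "(1 - s) *\<^sub>R x + s *\<^sub>R closest_point \<Omega> (x - \<mu> *\<^sub>R F x) \<in> \<Omega>"
    using convex assms unfolding convex_alt by blast
  then show ?thesis
    by (simp add: projection_residual_def algebra_simps)
qed

text \<open>The projection inequality at \<open>z = x\<close>. This bound is what makes short trial
  steps acceptable to the line search.\<close>

lemma inner_residual_ge: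
  assumes "x \<in> \<Omega>" "\<mu> > 0"
  shows "F x \<bullet> \<rho> \<mu> x \<ge> (norm (\<rho> \<mu> x))\<^sup>2 / \<mu>"
  using residual_variational[OF assms(1), of \<mu> x] assms(2)
  by (simp add: inner_diff_left power2_norm_eq_inner field_simps)

text \<open>A zero residual turns the projection inequality into the VI scaled by \<mu>. Conversely,
  the VI tested at the projected point is compatible with \<open>inner_residual_ge\<close> only if
  the residual is zero.\<close>

lemma residual_eq_0_iff:
  assumes "x \<in> \<Omega>" "\<mu> > 0"
  shows "\<rho> \<mu> x = 0 \<longleftrightarrow> VI_solution F \<Omega> x"
proof
  assume "\<rho> \<mu> x = 0"
  then have "\<mu> * (F x \<bullet> (z - x)) \<ge> 0" if "z \<in> \<Omega>" for z
    using residual_variational[OF that, of \<mu> x] by simp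
  then show "VI_solution F \<Omega> x"
    using assms by (simp add: VI_solution_def zero_le_mult_iff)
next
  assume "VI_solution F \<Omega> x"
  then have "F x \<bullet> \<rho> \<mu> x \<le> 0"
    using segment_to_projection[OF assms(1), of 1 \<mu>]
    unfolding VI_solution_def by (fastforce simp: inner_diff_right)
  then have "(norm (\<rho> \<mu> x))\<^sup>2 / \<mu> \<le> 0"
    using inner_residual_ge[OF assms] by linarith
  then show "\<rho> \<mu> x = 0"
    using assms(2) by (simp add: divide_le_0_iff)
qed

text \<open>Adding the projection inequalities of the two steps, the one for step 1 weighted by
  \<mu>, Cauchy-Schwarz yields
  \<open>(norm ?a - \<mu> * norm ?b) * (norm ?a - norm ?b) \<le> 0\<close>. So
  \<open>norm ?a\<close> lies between \<open>\<mu> * norm ?b\<close> and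
  \<open>norm ?b\<close>.\<close>

lemma residual_scaling:
  assumes "0 < \<mu>" "\<mu> \<le> 1"
  shows "\<mu> * norm (\<rho> 1 x) \<le> norm (\<rho> \<mu> x)"
proof (rule ccontr)
  let ?a = "\<rho> \<mu> x" and ?b = "\<rho> 1 x"
  assume less: "\<not> \<mu> * norm ?b \<le> norm ?a"
  have in\<Omega>: "x - \<rho> s x \<in> \<Omega>" for s
    using closest_point_in_set[OF closed nonempty] by (simp add: projection_residual_def)
  have "(?b - F x) \<bullet> (?b - ?a) \<le> 0" "(?a - \<mu> *\<^sub>R F x) \<bullet> (?a - ?b) \<le> 0"
    using residual_variational[OF in\<Omega>[of \<mu>], of 1 x] residual_variational[OF in\<Omega>[of 1], of \<mu> x]
    by simp_all
  then have "\<mu> * ((?b - F x) \<bullet> (?b - ?a)) + (?a - \<mu> *\<^sub>R F x) \<bullet> (?a - ?b) \<le> 0"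
    using assms by (simp add: add_nonpos_nonpos mult_nonneg_nonpos)
  then have "(norm ?a)\<^sup>2 + \<mu> * (norm ?b)\<^sup>2 \<le> (1 + \<mu>) * (?a \<bullet> ?b)"
    by (simp add: power2_norm_eq_inner inner_diff_left inner_diff_right inner_commute algebra_simps)
  also have "\<dots> \<le> (1 + \<mu>) * (norm ?a * norm ?b)"
    using assms by (intro mult_left_mono norm_cauchy_schwarz) simp
  finally have "(norm ?a - \<mu> * norm ?b) * (norm ?a - norm ?b) \<le> 0"
    by (simp add: power2_eq_square algebra_simps)
  moreover have "\<mu> * norm ?b \<le> norm ?b"
    using assms mult_right_mono[of \<mu> 1 "norm ?b"] by simp
  ultimately show False
    using less mult_neg_neg[of "norm ?a - \<mu> * norm ?b" "norm ?a - norm ?b"] by linarith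
qed

lemma continuous_residual: "continuous_on \<Omega> (\<rho> \<mu>)"
proof -
  have "continuous_on \<Omega> (closest_point \<Omega> \<circ> (\<lambda>x. x - \<mu> *\<^sub>R F x))"
    by (intro continuous_on_compose continuous_intros cont
        continuous_on_closest_point[OF convex closed nonempty])
  then show ?thesis
    unfolding projection_residual_def comp_def by (intro continuous_intros)
qed

text \<open>Brouwer's theorem for the projected step, whose fixed points are the zeros of the
  residual of step 1.\<close>

lemma solution_exists: "\<exists>x. VI_solution F \<Omega> x"
proof -
  have "continuous_on \<Omega> (\<lambda>x. x - \<rho> 1 x)"
    by (intro continuous_intros continuous_residual)
  moreover have "(\<lambda>x. x - \<rho> 1 x) ` \<Omega> \<subseteq> \<Omega>"
    using segment_to_projection[of _ 1 1] by auto
  ultimately obtain x where "x \<in> \<Omega>" "x - \<rho> 1 x = x"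
    using brouwer[OF compact convex nonempty, of "\<lambda>x. x - \<rho> 1 x"] by blast
  then show ?thesis
    using residual_eq_0_iff[of x 1] by auto
qed

text \<open>Minty's inequality: monotonicity replaces \<open>F z\<close> by \<open>F y\<close> in
  the VI. It keeps every solution inside every half-space of the method.\<close>

lemma solution_separated:
  assumes "VI_solution F \<Omega> z" "y \<in> \<Omega>"
  shows "F y \<bullet> (z - y) \<le> 0"
proof -
  have "F z \<bullet> (y - z) \<ge> 0" "(F z - F y) \<bullet> (z - y) \<ge> 0"
    using assms mono by (auto simp: VI_solution_def monotone_operator_on_def)
  then show ?thesis
    by (simp add: inner_diff_left inner_diff_right)
qed

end

section \<open>The iteration and its well-definedness\<close>

locale sspm_run = monotone_VI F \<Omega>
  for F :: "'a::euclidean_space \<Rightarrow> 'a" and \<Omega> :: "'a set" +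
  fixes P :: sspm_params and x0 :: 'a
  assumes params: "sspm_params_ok P" and x0: "x0 \<in> \<Omega>"
begin

abbreviation "X k \<equiv> sspm_iterate P F \<Omega> x0 k"
text \<open>The stored step lags by one: \<open>\<eta> k\<close> enters iteration \<open>k\<close>,
  and \<open>\<eta> (Suc k)\<close> is the step accepted in it. Hence \<open>Y k\<close> uses the
  latter.\<close>

abbreviation "\<eta> k \<equiv> snd (sspm_state P F \<Omega> x0 k)"
abbreviation "\<mu> k \<equiv> step_mu P (\<eta> k)"
abbreviation "V k \<equiv> \<rho> (\<mu> k) (X k)"
abbreviation "Y k \<equiv> X k - \<eta> (Suc k) *\<^sub>R V k"
abbreviation "ls k \<equiv> line_search_ok P F \<Omega> (X k) (\<eta> k)"

lemma step_nu_eq: "step_nu P F \<Omega> x e = \<rho> (step_mu P e) x"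
  by (simp add: step_nu_def projection_residual_def)

lemma sspm_residual_eq: "sspm_residual P F \<Omega> x0 k = V k"
  by (simp add: sspm_residual_def sspm_iterate_def step_nu_eq split: prod.split)

lemma eta_Suc: "\<eta> (Suc k) = gamma1 P ^ (LEAST \<zeta>. ls k \<zeta>) * \<mu> k"
  by (simp add: sspm_state.simps(2) sspm_iterate_def step_eta_def split: prod.split)

lemma halfspace_eq: "step_halfspace P F \<Omega> (X k) (\<eta> k) = {z. F (Y k) \<bullet> (z - Y k) \<le> 0}"
  by (simp add: step_halfspace_def Let_def step_nu_eq sspm_state.simps(2) sspm_iterate_def split: prod.split)

lemma iterate_Suc: "X (Suc k) = closest_point (\<Omega> \<inter> {z. F (Y k) \<bullet> (z - Y k) \<le> 0}) (X k)"
  unfolding halfspace_eq[symmetric] by (simp add: sspm_state.simps(2) sspm_iterate_def split: prod.split)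

lemma ls_iff:
  "ls k \<zeta> \<longleftrightarrow> F (X k - (gamma1 P ^ \<zeta> * \<mu> k) *\<^sub>R V k) \<bullet> V k \<ge> gamma2 P / \<mu> k * (norm (V k))\<^sup>2"
  by (simp add: line_search_ok_def step_nu_eq)

lemma step_mu_bounds: "e > 0 \<Longrightarrow> 0 < step_mu P e \<and> step_mu P e \<le> 1"
  using params by (simp add: sspm_params_ok_def step_mu_def)

lemma search_in_\<Omega>:
  assumes "X k \<in> \<Omega>" "\<eta> k > 0"
  shows "X k - (gamma1 P ^ \<zeta> * \<mu> k) *\<^sub>R V k \<in> \<Omega>"
  using params step_mu_bounds[OF assms(2)]
  by (intro segment_to_projection assms) (auto simp: sspm_params_ok_def intro!: mult_le_one power_le_one)

text \<open>As the trial step shrinks, the left side tends to \<open>F (X k) \<bullet> V k\<close>,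
  which is at least \<open>(norm (V k))\<^sup>2 / \<mu> k\<close> and so strictly above the required
  bound, because \<open>gamma2 P < 1\<close>. If \<open>V k = 0\<close>, both sides are 0.\<close>

lemma line_search_terminates:
  assumes "X k \<in> \<Omega>" "\<eta> k > 0"
  shows "\<exists>\<zeta>. ls k \<zeta>"
proof (cases "V k = 0")
  case True
  then show ?thesis by (simp add: ls_iff)
next
  case False
  have \<mu>: "0 < \<mu> k" using step_mu_bounds[OF assms(2)] by simp
  have \<gamma>: "0 < gamma1 P" "gamma1 P < 1" "gamma2 P < 1" using params by (auto simp: sspm_params_ok_def)
  have "(\<lambda>\<zeta>. X k - (gamma1 P ^ \<zeta> * \<mu> k) *\<^sub>R V k) \<longlonglongrightarrow> X k - (0 * \<mu> k) *\<^sub>R V k"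
    using \<gamma> by (intro tendsto_intros LIMSEQ_realpow_zero) auto
  then have "(\<lambda>\<zeta>. F (X k - (gamma1 P ^ \<zeta> * \<mu> k) *\<^sub>R V k)) \<longlonglongrightarrow> F (X k)"
    by (intro continuous_on_tendsto_compose[OF cont _ assms(1)] always_eventually allI
        search_in_\<Omega>[OF assms]) simp
  then have "(\<lambda>\<zeta>. F (X k - (gamma1 P ^ \<zeta> * \<mu> k) *\<^sub>R V k) \<bullet> V k) \<longlonglongrightarrow> F (X k) \<bullet> V k"
    by (intro tendsto_intros)
  moreover have "gamma2 P / \<mu> k * (norm (V k))\<^sup>2 < F (X k) \<bullet> V k"
  proof -
    have "gamma2 P / \<mu> k * (norm (V k))\<^sup>2 < 1 / \<mu> k * (norm (V k))\<^sup>2"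
      using \<gamma> \<mu> False by (intro mult_strict_right_mono divide_strict_right_mono) auto
    then show ?thesis using inner_residual_ge[OF assms(1) \<mu>] by simp
  qed
  ultimately have "\<forall>\<^sub>F \<zeta> in sequentially. gamma2 P / \<mu> k * (norm (V k))\<^sup>2
      < F (X k - (gamma1 P ^ \<zeta> * \<mu> k) *\<^sub>R V k) \<bullet> V k"
    by (rule order_tendstoD)
  then show ?thesis
    unfolding ls_iff eventually_sequentially by (meson less_imp_le order_refl)
qed

lemma solution_in_halfspace:
  assumes "X k \<in> \<Omega>" "\<eta> k > 0" "VI_solution F \<Omega> z"
  shows "z \<in> \<Omega> \<inter> {z. F (Y k) \<bullet> (z - Y k) \<le> 0}"
  using assms(3) solution_separated[OF assms(3)] search_in_\<Omega>[OF assms(1,2)]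
  by (simp add: VI_solution_def eta_Suc)

lemma closed_convex_cut:
  "closed (\<Omega> \<inter> {z. F y \<bullet> (z - y) \<le> 0})" "convex (\<Omega> \<inter> {z. F y \<bullet> (z - y) \<le> 0})"
proof -
  have "{z. F y \<bullet> (z - y) \<le> 0} = {z. F y \<bullet> z \<le> F y \<bullet> y}" by (simp add: inner_diff_right)
  then show "closed (\<Omega> \<inter> {z. F y \<bullet> (z - y) \<le> 0})" "convex (\<Omega> \<inter> {z. F y \<bullet> (z - y) \<le> 0})"
    using closed convex by (auto intro!: closed_Int convex_Int closed_halfspace_le convex_halfspace_le)
qed

text \<open>A solution of the VI witnesses that the cut is nonempty, so that
  \<open>closest_point\<close> really projects; placing it in the cut uses the induction
  hypothesis.\<close>

lemma invariant: "X k \<in> \<Omega> \<and> \<eta> k > 0"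
proof (induction k)
  case 0
  then show ?case using x0 params by (simp add: sspm_iterate_def sspm_params_ok_def)
next
  case (Suc k)
  obtain z where "VI_solution F \<Omega> z" using solution_exists by blast
  then have "\<Omega> \<inter> {z. F (Y k) \<bullet> (z - Y k) \<le> 0} \<noteq> {}"
    using Suc solution_in_halfspace by blast
  then have "X (Suc k) \<in> \<Omega>"
    unfolding iterate_Suc using closest_point_in_set[OF closed_convex_cut(1)] by blast
  moreover have "\<eta> (Suc k) > 0"
    unfolding eta_Suc using Suc step_mu_bounds params by (simp add: sspm_params_ok_def)
  ultimately show ?case by simp
qed

lemma X_in [simp]: "X k \<in> \<Omega>" and eta_pos [simp]: "\<eta> k > 0"
  using invariant by auto

lemma eta_nonneg [simp]: "\<eta> k \<ge> 0"
  using eta_pos by (rule less_imp_le)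

lemma mu_pos [simp]: "\<mu> k > 0" and mu_le_1: "\<mu> k \<le> 1"
  using step_mu_bounds[of "\<eta> k"] by auto

lemma cut_nonempty: "\<Omega> \<inter> {z. F (Y k) \<bullet> (z - Y k) \<le> 0} \<noteq> {}"
  using solution_exists solution_in_halfspace[OF X_in eta_pos] by blast

lemma well_defined: "sspm_well_defined P F \<Omega> x0"
proof -
  have "(\<exists>\<zeta>. ls k \<zeta>) \<and> \<Omega> \<inter> step_halfspace P F \<Omega> (X k) (\<eta> k) \<noteq> {}" for k
    using line_search_terminates cut_nonempty unfolding halfspace_eq by simp
  then show ?thesis
    by (auto simp: sspm_well_defined_def sspm_iterate_def split: prod.split) (metis fst_conv snd_conv)+
qed

lemma eta_le_mu: "\<eta> (Suc k) \<le> \<mu> k"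
proof -
  have "gamma1 P ^ (LEAST \<zeta>. ls k \<zeta>) \<le> 1"
    using params by (intro power_le_one) (auto simp: sspm_params_ok_def)
  then show ?thesis
    unfolding eta_Suc using mu_pos[of k] mult_right_mono[of _ 1 "\<mu> k"] by simp
qed

lemma Y_in: "Y k \<in> \<Omega>"
  unfolding eta_Suc by (intro search_in_\<Omega> X_in eta_pos)

lemma line_search_accepted: "F (Y k) \<bullet> V k \<ge> gamma2 P / \<mu> k * (norm (V k))\<^sup>2"
  using LeastI_ex[OF line_search_terminates[OF X_in eta_pos]] unfolding ls_iff eta_Suc .

section \<open>Fejer monotonicity and line search estimates\<close>

lemma fejer:
  assumes "VI_solution F \<Omega> z"
  shows "(dist (X (Suc k)) z)\<^sup>2 + (dist (X (Suc k)) (X k))\<^sup>2 \<le> (dist (X k) z)\<^sup>2"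
proof -
  \<comment> \<open>Obtuse-angle property of the projection onto the cut, which contains
    \<open>z\<close>. Expanding the squares gives the claim.\<close>
  have "(X k - X (Suc k)) \<bullet> (z - X (Suc k)) \<le> 0"
    unfolding iterate_Suc
    by (intro closest_point_dot closed_convex_cut solution_in_halfspace assms X_in eta_pos)
  then show ?thesis
    by (simp add: dist_norm power2_norm_eq_inner inner_diff_left inner_diff_right inner_commute)
qed

lemma dist_solution_decseq:
  assumes "VI_solution F \<Omega> z"
  shows "decseq (\<lambda>k. dist (X k) z)"
proof (rule decseq_SucI)
  fix k
  have "(dist (X (Suc k)) z)\<^sup>2 \<le> (dist (X k) z)\<^sup>2"
    using fejer[OF assms, of k] zero_le_power2[of "dist (X (Suc k)) (X k)"] by linarith
  then show "dist (X (Suc k)) z \<le> dist (X k) z"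
    by (rule power2_le_imp_le) simp
qed

text \<open>The squared distances to a fixed solution converge, so their successive differences
  vanish, and by \<open>fejer\<close> these dominate the squared moves.\<close>

lemma step_vanishes: "(\<lambda>k. dist (X (Suc k)) (X k)) \<longlonglongrightarrow> 0"
proof -
  obtain z where z: "VI_solution F \<Omega> z" using solution_exists by blast
  obtain L where "(\<lambda>k. dist (X k) z) \<longlonglongrightarrow> L"
    using decseq_convergent[OF dist_solution_decseq[OF z], of 0] by auto
  then have "(\<lambda>k. (dist (X k) z)\<^sup>2 - (dist (X (Suc k)) z)\<^sup>2) \<longlonglongrightarrow> L\<^sup>2 - L\<^sup>2"
    by (intro tendsto_intros LIMSEQ_Suc)
  then have "(\<lambda>k. (dist (X k) z)\<^sup>2 - (dist (X (Suc k)) z)\<^sup>2) \<longlonglongrightarrow> 0" by simp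
  then have "(\<lambda>k. (dist (X (Suc k)) (X k))\<^sup>2) \<longlonglongrightarrow> 0"
    by (rule Lim_null_comparison[rotated]) (use fejer[OF z] in \<open>auto intro!: always_eventually simp: algebra_simps\<close>)
  then show ?thesis
    using tendsto_real_sqrt[of _ 0] by fastforce
qed

text \<open>The line search makes \<open>X k\<close> violate the half-space by an amount controlled
  by the residual. Since \<open>F\<close> is bounded, a large violation forces a long move, but the
  moves vanish.\<close>

lemma eta_residual_vanishes: "(\<lambda>k. \<eta> (Suc k) * norm (\<rho> 1 (X k))) \<longlonglongrightarrow> 0"
proof -
  have "bounded (F ` \<Omega>)"
    using compact_continuous_image[OF cont compact] by (rule compact_imp_bounded)
  then obtain M where M: "M > 0" "\<And>x. x \<in> \<Omega> \<Longrightarrow> norm (F x) \<le> M"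
    unfolding bounded_pos by blast
  have \<gamma>: "gamma2 P > 0" using params by (simp add: sspm_params_ok_def)
  have "(\<eta> (Suc k) * norm (\<rho> 1 (X k)))\<^sup>2 \<le> M / gamma2 P * dist (X (Suc k)) (X k)" for k
  proof -
    have "X (Suc k) \<in> \<Omega> \<inter> {z. F (Y k) \<bullet> (z - Y k) \<le> 0}"
      unfolding iterate_Suc by (rule closest_point_in_set[OF closed_convex_cut(1) cut_nonempty])
    \<comment> \<open>The half-space condition on \<open>X (Suc k)\<close>, rewritten with
      \<open>X k - Y k = \<eta> (Suc k) *\<^sub>R V k\<close>.\<close>
    then have "\<eta> (Suc k) * (F (Y k) \<bullet> V k) \<le> F (Y k) \<bullet> (X k - X (Suc k))"
      by (simp add: inner_diff_right)
    also have "\<dots> \<le> norm (F (Y k)) * norm (X k - X (Suc k))" by (rule norm_cauchy_schwarz)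
    also have "\<dots> \<le> M * dist (X (Suc k)) (X k)"
      using M(2)[OF Y_in] by (simp add: dist_norm norm_minus_commute mult_right_mono)
    finally have "\<eta> (Suc k) * (F (Y k) \<bullet> V k) \<le> M * dist (X (Suc k)) (X k)" .
    moreover have "\<eta> (Suc k) * (gamma2 P / \<mu> k * (norm (V k))\<^sup>2) \<le> \<eta> (Suc k) * (F (Y k) \<bullet> V k)"
      by (intro mult_left_mono line_search_accepted eta_nonneg)
    \<comment> \<open>Passing from \<open>V k\<close> to the residual of step 1 leaves a factor
      \<open>\<mu> k\<close>, which is bounded below by \<open>\<eta> (Suc k)\<close>.\<close>
    moreover have "gamma2 P * (\<eta> (Suc k) * norm (\<rho> 1 (X k)))\<^sup>2
        \<le> \<eta> (Suc k) * (gamma2 P / \<mu> k * (norm (V k))\<^sup>2)"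
    proof -
      have "(\<mu> k * norm (\<rho> 1 (X k)))\<^sup>2 \<le> (norm (V k))\<^sup>2"
        using residual_scaling[OF mu_pos mu_le_1] less_imp_le[OF mu_pos[of k]] by (intro power_mono) auto
      then have "\<mu> k * (norm (\<rho> 1 (X k)))\<^sup>2 \<le> (norm (V k))\<^sup>2 / \<mu> k"
        using mu_pos[of k] by (simp add: field_simps power2_eq_square)
      moreover have "\<eta> (Suc k) * (norm (\<rho> 1 (X k)))\<^sup>2 \<le> \<mu> k * (norm (\<rho> 1 (X k)))\<^sup>2"
        by (intro mult_right_mono eta_le_mu) simp
      ultimately have "\<eta> (Suc k) * (norm (\<rho> 1 (X k)))\<^sup>2 \<le> (norm (V k))\<^sup>2 / \<mu> k" by linarith
      then have "(gamma2 P * \<eta> (Suc k)) * (\<eta> (Suc k) * (norm (\<rho> 1 (X k)))\<^sup>2)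
          \<le> (gamma2 P * \<eta> (Suc k)) * ((norm (V k))\<^sup>2 / \<mu> k)"
        using \<gamma> eta_nonneg[of "Suc k"] by (intro mult_left_mono) auto
      then show ?thesis by (simp add: power2_eq_square algebra_simps)
    qed
    ultimately have "gamma2 P * (\<eta> (Suc k) * norm (\<rho> 1 (X k)))\<^sup>2 \<le> M * dist (X (Suc k)) (X k)"
      by linarith
    then show ?thesis using \<gamma> by (simp add: pos_le_divide_eq mult.commute)
  qed
  then have "\<forall>\<^sub>F k in sequentially. norm ((\<eta> (Suc k) * norm (\<rho> 1 (X k)))\<^sup>2)
      \<le> M / gamma2 P * dist (X (Suc k)) (X k)"
    by (intro always_eventually) simp
  moreover have "(\<lambda>k. M / gamma2 P * dist (X (Suc k)) (X k)) \<longlonglongrightarrow> 0"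
    using tendsto_mult_left[OF step_vanishes, of "M / gamma2 P"] by simp
  ultimately have "(\<lambda>k. (\<eta> (Suc k) * norm (\<rho> 1 (X k)))\<^sup>2) \<longlonglongrightarrow> 0"
    by (rule Lim_null_comparison)
  then have "(\<lambda>k. sqrt ((\<eta> (Suc k) * norm (\<rho> 1 (X k)))\<^sup>2)) \<longlonglongrightarrow> sqrt 0"
    by (rule tendsto_real_sqrt)
  then show ?thesis by (simp add: abs_mult)
qed

text \<open>Exponent 0 accepts \<open>\<mu> k\<close> itself; otherwise the preceding trial step,
  larger by the factor \<open>1 / gamma1 P\<close>, was rejected. Rejection against
  \<open>inner_residual_ge\<close> shows that \<open>F\<close> must vary between \<open>X k\<close>
  and that trial point at least in proportion to the residual.\<close>

lemma rejected_step:
  assumes "\<eta> (Suc k) \<noteq> \<mu> k"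
  shows "X k - (\<eta> (Suc k) / gamma1 P) *\<^sub>R V k \<in> \<Omega>"
    and "(1 - gamma2 P) * norm (\<rho> 1 (X k))
      \<le> norm (F (X k) - F (X k - (\<eta> (Suc k) / gamma1 P) *\<^sub>R V k))"
proof -
  have \<gamma>: "0 < gamma1 P" "gamma2 P < 1" using params by (auto simp: sspm_params_ok_def)
  define \<zeta> where "\<zeta> = (LEAST \<zeta>. ls k \<zeta>)"
  have "\<zeta> \<noteq> 0" using assms unfolding eta_Suc \<zeta>_def[symmetric] by (metis mult_1 power_0)
  then obtain n where n: "\<zeta> = Suc n" by (cases \<zeta>) auto
  have eq: "\<eta> (Suc k) / gamma1 P = gamma1 P ^ n * \<mu> k"
    unfolding eta_Suc \<zeta>_def[symmetric] n using \<gamma> by simp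
  show "X k - (\<eta> (Suc k) / gamma1 P) *\<^sub>R V k \<in> \<Omega>"
    unfolding eq by (intro search_in_\<Omega> X_in eta_pos)
  define w where "w = X k - (\<eta> (Suc k) / gamma1 P) *\<^sub>R V k"
  have "\<not> ls k n" using not_less_Least[of n "ls k"] n \<zeta>_def by simp
  then have rej: "F w \<bullet> V k < gamma2 P / \<mu> k * (norm (V k))\<^sup>2"
    unfolding ls_iff w_def eq by simp
  then have "V k \<noteq> 0" by auto
  have "(1 - gamma2 P) / \<mu> k * (norm (V k))\<^sup>2 \<le> (F (X k) - F w) \<bullet> V k"
    using rej inner_residual_ge[OF X_in mu_pos, of k k]
    by (simp add: inner_diff_left left_diff_distrib diff_divide_distrib)
  also have "\<dots> \<le> norm (F (X k) - F w) * norm (V k)" by (rule norm_cauchy_schwarz)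
  finally have "(1 - gamma2 P) * (norm (V k) / \<mu> k) \<le> norm (F (X k) - F w)"
    using \<open>V k \<noteq> 0\<close> by (simp add: power2_eq_square flip: mult.assoc times_divide_eq_left)
  moreover have "norm (\<rho> 1 (X k)) \<le> norm (V k) / \<mu> k"
    using residual_scaling[OF mu_pos mu_le_1, of k "X k"] mu_pos[of k] by (simp add: field_simps)
  then have "(1 - gamma2 P) * norm (\<rho> 1 (X k)) \<le> (1 - gamma2 P) * (norm (V k) / \<mu> k)"
    using \<gamma> by (intro mult_left_mono) auto
  ultimately show "(1 - gamma2 P) * norm (\<rho> 1 (X k))
      \<le> norm (F (X k) - F (X k - (\<eta> (Suc k) / gamma1 P) *\<^sub>R V k))"
    unfolding w_def by linarith
qed

section \<open>Vanishing residuals and convergence of the iterates\<close>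

text \<open>
  If the residuals stayed away from zero, the step sizes would tend to zero. For small step sizes,
  uniform continuity of \<open>F\<close> makes the first trial step acceptable, so that the step
  size grows by the factor \<^term>\<open>gamma3 P\<close>.
\<close>

lemma residual_arbitrarily_small:
  assumes "e > 0"
  shows "\<exists>k. norm (\<rho> 1 (X k)) < e"
proof (rule ccontr)
  assume "\<not> ?thesis"
  then have ge: "norm (\<rho> 1 (X k)) \<ge> e" for k by (simp add: not_less)
  have \<gamma>: "0 < gamma1 P" "gamma2 P < 1" "gamma3 P > 1" using params by (auto simp: sspm_params_ok_def)
  have "(\<lambda>k. \<eta> (Suc k) * norm (\<rho> 1 (X k)) / e) \<longlonglongrightarrow> 0"
    using tendsto_divide[OF eta_residual_vanishes tendsto_const[of e]] assms by simp
  moreover have "norm (\<eta> (Suc k)) \<le> \<eta> (Suc k) * norm (\<rho> 1 (X k)) / e" for k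
  proof -
    have "\<eta> (Suc k) * e \<le> \<eta> (Suc k) * norm (\<rho> 1 (X k))"
      by (intro mult_left_mono ge eta_nonneg)
    then show ?thesis
      using assms eta_nonneg[of "Suc k"] by (simp add: pos_le_divide_eq)
  qed
  ultimately have "(\<lambda>k. \<eta> (Suc k)) \<longlonglongrightarrow> 0"
    by (intro Lim_null_comparison[of "\<lambda>k. \<eta> (Suc k)"]) (auto intro: always_eventually)
  then have lim: "\<eta> \<longlonglongrightarrow> 0" by (rule LIMSEQ_imp_Suc)
  have "uniformly_continuous_on \<Omega> F" using cont compact by (rule compact_uniformly_continuous)
  moreover have "(1 - gamma2 P) * e > 0" using \<gamma> assms by simp
  ultimately obtain \<delta> where \<delta>: "\<delta> > 0"
    "\<And>x y. x \<in> \<Omega> \<Longrightarrow> y \<in> \<Omega> \<Longrightarrow> dist x y < \<delta> \<Longrightarrow> dist (F x) (F y) < (1 - gamma2 P) * e"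
    unfolding uniformly_continuous_on_def by (metis dist_commute)
  obtain D where D: "D > 0" "\<And>x. x \<in> \<Omega> \<Longrightarrow> norm x \<le> D"
    using compact_imp_bounded[OF compact] unfolding bounded_pos by blast
  have V: "norm (V k) \<le> 2 * D" for k
  proof -
    have "X k - V k \<in> \<Omega>" using segment_to_projection[OF X_in, of 1] by simp
    then have "norm (X k - V k) \<le> D" "norm (X k) \<le> D" using D(2) by auto
    then show ?thesis using norm_triangle_ineq4[of "X k" "X k - V k"] by simp
  qed
  \<comment> \<open>Below the first bound the cap 1 in \<open>step_mu\<close> is inactive, so the
    trial step is \<open>gamma3 P * \<eta> k\<close>. Below the second, a rejected trial point is
    within \<delta> of \<open>X k\<close>, as \<open>norm (V k) \<le> 2 * D\<close>.\<close>
  define b where "b = min (1 / gamma3 P) (\<delta> * gamma1 P / (2 * D))"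
  have "b > 0" using \<gamma> \<delta> D by (simp add: b_def)
  then obtain n where n: "\<And>k. k \<ge> n \<Longrightarrow> \<eta> k < b"
    using order_tendstoD(2)[OF lim] unfolding eventually_sequentially by blast
  have grow: "\<eta> k \<le> \<eta> (Suc k)" if "k \<ge> n" for k
  proof (cases "\<eta> (Suc k) = \<mu> k")
    case True
    have "\<eta> k < 1 / gamma3 P" using n[OF that] by (simp add: b_def)
    then have "gamma3 P * \<eta> k < 1" using \<gamma> by (simp add: field_simps)
    then have "\<mu> k = gamma3 P * \<eta> k" by (simp add: step_mu_def)
    then show ?thesis using True \<gamma> eta_pos[of k] by simp
  next
    \<comment> \<open>This case is contradictory: the rejected point is so close that
      \<open>F\<close> varies less than \<open>rejected_step\<close> demands.\<close>
    case False
    note rej = rejected_step[OF False]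
    define w where "w = X k - (\<eta> (Suc k) / gamma1 P) *\<^sub>R V k"
    have "dist (X k) w = \<eta> (Suc k) / gamma1 P * norm (V k)"
      using \<gamma> eta_pos[of "Suc k"] by (simp add: w_def dist_norm)
    also have "\<dots> \<le> \<eta> (Suc k) / gamma1 P * (2 * D)"
      using \<gamma> eta_nonneg[of "Suc k"] by (intro mult_left_mono V) auto
    also have "\<dots> < \<delta>"
      using n[of "Suc k"] that \<gamma> D by (simp add: b_def field_simps)
    finally have "dist (F (X k)) (F w) < (1 - gamma2 P) * e"
      using \<delta>(2) rej(1) X_in unfolding w_def by blast
    moreover have "(1 - gamma2 P) * e \<le> (1 - gamma2 P) * norm (\<rho> 1 (X k))"
      using \<gamma> by (intro mult_left_mono ge) auto
    ultimately show ?thesis using rej(2) by (simp add: w_def dist_norm)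
  qed
  have "\<eta> n \<le> \<eta> k" if "k \<ge> n" for k
    using that by (induction rule: dec_induct) (use grow order_trans in blast)+
  \<comment> \<open>Positive steps that are nondecreasing from \<open>n\<close> on cannot tend to
    0.\<close>
  then have "\<eta> n \<le> 0"
    by (intro tendsto_lowerbound[OF lim]) (auto simp: eventually_sequentially)
  then show False using eta_pos[of n] by simp
qed

lemma converges: "\<exists>z. VI_solution F \<Omega> z \<and> X \<longlonglongrightarrow> z"
proof -
  obtain f where f: "\<And>n. norm (\<rho> 1 (X (f n))) < inverse (real (Suc n))"
  proof -
    have "\<forall>n. \<exists>k. norm (\<rho> 1 (X k)) < inverse (real (Suc n))"
      by (intro allI residual_arbitrarily_small) simp
    then show ?thesis using that by metis
  qed
  obtain z s where z: "z \<in> \<Omega>" "strict_mono s" "((\<lambda>n. X (f n)) \<circ> s) \<longlonglongrightarrow> z"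
    using compact[unfolded compact_def] X_in by metis
  then have lim: "(\<lambda>n. X (f (s n))) \<longlonglongrightarrow> z" by (simp add: o_def)
  have "(\<lambda>n. \<rho> 1 (X (f n))) \<longlonglongrightarrow> 0"
    by (rule Lim_null_comparison[OF _ LIMSEQ_inverse_real_of_nat])
      (use f in \<open>auto intro!: always_eventually less_imp_le\<close>)
  then have "(\<lambda>n. \<rho> 1 (X (f (s n)))) \<longlonglongrightarrow> 0"
    using LIMSEQ_subseq_LIMSEQ[OF _ z(2)] by (fastforce simp: o_def)
  moreover have "(\<lambda>n. \<rho> 1 (X (f (s n)))) \<longlonglongrightarrow> \<rho> 1 z"
    using continuous_on_tendsto_compose[OF continuous_residual lim z(1)] by simp
  ultimately have "\<rho> 1 z = 0" using LIMSEQ_unique by blast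
  then have sol: "VI_solution F \<Omega> z" using residual_eq_0_iff z(1) by simp
  have "X \<longlonglongrightarrow> z"
  proof (rule metric_LIMSEQ_I)
    fix e :: real assume "e > 0"
    then obtain n where "dist (X (f (s n))) z < e" using metric_LIMSEQ_D[OF lim] by blast
    then show "\<exists>no. \<forall>k\<ge>no. dist (X k) z < e"
      using dist_solution_decseq[OF sol] unfolding decseq_def by (meson le_less_trans)
  qed
  then show ?thesis using sol by blast
qed

text \<open>The steps \<open>\<mu> k\<close> vary and need not converge, so continuity of a single
  residual map is not enough. Comparing with the zero residual of the limit through nonexpansiveness
  of the projection gives a bound uniform in the step.\<close>

lemma residual_vanishes: "V \<longlonglongrightarrow> 0"
proof -
  obtain z where z: "VI_solution F \<Omega> z" "X \<longlonglongrightarrow> z" using converges by blast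
  then have "z \<in> \<Omega>" by (simp add: VI_solution_def)
  have bound: "norm (V k) \<le> 2 * norm (X k - z) + norm (F (X k) - F z)" for k
  proof -
    let ?p = "\<lambda>x. closest_point \<Omega> (x - \<mu> k *\<^sub>R F x)"
    have "\<rho> (\<mu> k) z = 0" using residual_eq_0_iff[OF \<open>z \<in> \<Omega>\<close> mu_pos] z by simp
    then have "V k = (X k - z) + (?p z - ?p (X k))" by (simp add: projection_residual_def)
    then have "norm (V k) \<le> norm (X k - z) + norm (?p z - ?p (X k))"
      by (metis norm_triangle_ineq)
    also have "norm (?p z - ?p (X k)) \<le> norm ((z - \<mu> k *\<^sub>R F z) - (X k - \<mu> k *\<^sub>R F (X k)))"
      using closest_point_lipschitz[OF convex closed nonempty] by (simp add: dist_norm)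
    also have "(z - \<mu> k *\<^sub>R F z) - (X k - \<mu> k *\<^sub>R F (X k)) = \<mu> k *\<^sub>R (F (X k) - F z) - (X k - z)"
      by (simp add: algebra_simps)
    also have "norm \<dots> \<le> \<mu> k * norm (F (X k) - F z) + norm (X k - z)"
      using norm_triangle_ineq4[of "\<mu> k *\<^sub>R (F (X k) - F z)" "X k - z"] mu_pos[of k] by simp
    also have "\<mu> k * norm (F (X k) - F z) \<le> norm (F (X k) - F z)"
      using mult_right_mono[OF mu_le_1] by fastforce
    finally show ?thesis by simp
  qed
  have "(\<lambda>k. F (X k)) \<longlonglongrightarrow> F z"
    using continuous_on_tendsto_compose[OF cont z(2) \<open>z \<in> \<Omega>\<close>] by simp
  then have "(\<lambda>k. 2 * norm (X k - z) + norm (F (X k) - F z)) \<longlonglongrightarrow> 2 * norm (z - z) + norm (F z - F z)"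
    by (intro tendsto_intros z(2))
  then have "(\<lambda>k. 2 * norm (X k - z) + norm (F (X k) - F z)) \<longlonglongrightarrow> 0" by simp
  then show ?thesis
    by (rule Lim_null_comparison[rotated]) (use bound in \<open>auto intro: always_eventually\<close>)
qed

section \<open>Termination and the output for small tolerances\<close>

lemma stops:
  assumes "e > 0"
  shows "\<exists>k. sspm_stops_at P F \<Omega> x0 e k"
  using metric_LIMSEQ_D[OF residual_vanishes assms]
  by (auto simp: sspm_stops_at_def sspm_residual_eq)

text \<open>A zero residual makes \<open>X k\<close> a solution, and the decreasing distance to it
  is already 0 at \<open>k\<close>.\<close>

lemma finite_termination:
  assumes "V k = 0" "X \<longlonglongrightarrow> z"
  shows "X k = z"
proof -
  have sol: "VI_solution F \<Omega> (X k)" using assms(1) residual_eq_0_iff[OF X_in mu_pos] by blast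
  have "X n = X k" if "n \<ge> k" for n
    using decseqD[OF dist_solution_decseq[OF sol] that] by simp
  then have "X \<longlonglongrightarrow> X k"
    by (intro tendsto_eventually eventually_sequentiallyI)
  then show ?thesis using assms(2) LIMSEQ_unique by blast
qed

text \<open>For a small tolerance the loop stops either late, where the iterates are close to
  \<open>z\<close>, or at an exact solution, which equals \<open>z\<close>.\<close>

lemma output_tendsto:
  assumes lim: "X \<longlonglongrightarrow> z"
  shows "(sspm_output P F \<Omega> x0 \<longlongrightarrow> z) (at_right 0)"
proof (rule tendstoI)
  fix d :: real assume "d > 0"
  then obtain N where N: "\<And>k. k \<ge> N \<Longrightarrow> dist (X k) z < d" using metric_LIMSEQ_D[OF lim] by blast
  \<comment> \<open>The nonzero residuals before \<open>N\<close>; a tolerance below all of them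
    excludes an early stop with nonzero residual. The element 1 keeps the set nonempty, so that
    \<open>Min A\<close> is meaningful.\<close>
  define A where "A = insert 1 ((\<lambda>k. norm (V k)) ` {k. k < N \<and> V k \<noteq> 0})"
  have A: "finite A" "A \<noteq> {}" "\<And>a. a \<in> A \<Longrightarrow> a > 0" by (auto simp: A_def)
  have "dist (sspm_output P F \<Omega> x0 e) z < d" if e: "0 < e" "e < Min A" for e
  proof -
    define k where "k = (LEAST k. sspm_stops_at P F \<Omega> x0 e k)"
    have "norm (V k) < e"
      using LeastI_ex[OF stops[OF e(1)]] by (simp add: k_def sspm_stops_at_def sspm_residual_eq)
    then have "norm (V k) \<notin> A"
      using e(2) Min_le[OF A(1)] by fastforce
    then have "k \<ge> N \<or> V k = 0" unfolding A_def by (auto simp: not_le)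
    then have "dist (X k) z < d" using N finite_termination[OF _ lim] \<open>d > 0\<close> by auto
    then show ?thesis by (simp add: sspm_output_def k_def)
  qed
  moreover have "Min A > 0" using A by simp
  ultimately show "\<forall>\<^sub>F e in at_right 0. dist (sspm_output P F \<Omega> x0 e) z < d"
    unfolding eventually_at_right_field by blast
qed

end

section \<open>Normalized Nash equilibria of the scheduling game\<close>

lemma vec_upd_same: "vec_upd x i (x $ i) = x"
  by (simp add: vec_upd_def vec_eq_iff)

lemma vec_upd_nth: "vec_upd x i s $ j = (if j = i then s else x $ j)"
  by (simp add: vec_upd_def)

text \<open>Each player's own strategy put back into the profile leaves the profile unchanged, so
  all the players' conditions coincide; there is at least one player because types are
  nonempty.\<close>

lemma Omega_iff_jointly_feasible: "x \<in> Omega S t \<longleftrightarrow> jointly_feasible S t x"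
  by (simp add: Omega_def strategy_set_def vec_upd_same)

text \<open>Charging and demand constrain the profile through one scalar, the served demand. This is
  why a single dual variable will serve both couplings.\<close>

lemma charged_energy_eq: "charged_energy S t x = r_charge S * ((\<Sum>j\<in>UNIV. m_veh S t j) - served_demand S t x)"
  by (simp add: charged_energy_def served_demand_def right_diff_distrib sum_subtractf)

lemma served_demand_add: "served_demand S t (x + v) = served_demand S t x + served_demand S t v"
  by (simp add: served_demand_def distrib_left sum.distrib)

lemma served_demand_diff: "served_demand S t (x - v) = served_demand S t x - served_demand S t v"
  by (simp add: served_demand_def right_diff_distrib sum_subtractf)

lemma served_demand_scaleR: "served_demand S t (a *\<^sub>R v) = a * served_demand S t v"
  by (simp add: served_demand_def sum_distrib_left mult.left_commute)

lemma served_demand_axis: "served_demand S t (axis i s) = m_veh S t i * s"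
  by (simp add: served_demand_def axis_def if_distrib[of "(*) _"] cong: if_cong)

lemma axis_component: "axis i s $ j = (if j = i then s else 0)"
  by (simp add: axis_def)

lemma served_demand_vec_upd:
  "served_demand S t (vec_upd x i s) = served_demand S t x + m_veh S t i * (s - x $ i)"
proof -
  have "vec_upd x i s = x + axis i (s - x $ i)"
    by (simp add: vec_eq_iff vec_upd_def axis_component)
  then show ?thesis
    by (simp add: served_demand_add served_demand_axis)
qed

lemma Omega_eq:
  "Omega S t = {x. charged_energy S t x = E_plus S t} \<inter> {x. served_demand S t x \<ge> d_tot S t} \<inter> cbox 0 1"
  by (auto simp: Omega_iff_jointly_feasible jointly_feasible_def mem_box_cart)

lemma compact_Omega: "compact (Omega S t)"
proof -
  have "closed {x. charged_energy S t x = E_plus S t}"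
    unfolding charged_energy_def by (intro closed_Collect_eq continuous_intros)
  moreover have "closed {x. served_demand S t x \<ge> d_tot S t}"
    unfolding served_demand_def by (intro closed_Collect_le continuous_intros)
  ultimately show ?thesis
    unfolding Omega_eq by (intro closed_Int_compact closed_Int compact_cbox)
qed

lemma convex_Omega: "convex (Omega S t)"
proof -
  have comb: "a * c + b * c = c" if "a + b = 1" for a b c :: real
    using that by (simp flip: distrib_right)
  have "convex {x. charged_energy S t x = E_plus S t}"
  proof (rule convexI, clarify)
    fix x y and u v :: real
    assume *: "0 \<le> u" "0 \<le> v" "u + v = 1" "charged_energy S t y = E_plus S t" "charged_energy S t x = E_plus S t"
    let ?M = "\<Sum>j\<in>UNIV. m_veh S t j"
    have "charged_energy S t (u *\<^sub>R x + v *\<^sub>R y) =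
        r_charge S * ((u * ?M + v * ?M) - (u * served_demand S t x + v * served_demand S t y))"
      using comb[OF *(3)] by (simp add: charged_energy_eq served_demand_add served_demand_scaleR)
    also have "\<dots> = u * charged_energy S t x + v * charged_energy S t y"
      unfolding charged_energy_eq by (simp only: algebra_simps)
    also have "\<dots> = E_plus S t" using * comb[OF *(3)] by simp
    finally show "charged_energy S t (u *\<^sub>R x + v *\<^sub>R y) = E_plus S t" .
  qed
  moreover have "convex {x. served_demand S t x \<ge> d_tot S t}"
  proof (rule convexI, clarify)
    fix x y and u v :: real
    assume *: "0 \<le> u" "0 \<le> v" "u + v = 1" "d_tot S t \<le> served_demand S t x" "d_tot S t \<le> served_demand S t y"
    have "u * d_tot S t + v * d_tot S t \<le> u * served_demand S t x + v * served_demand S t y"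
      using * by (intro add_mono mult_left_mono)
    then show "d_tot S t \<le> served_demand S t (u *\<^sub>R x + v *\<^sub>R y)"
      using comb[OF *(3)] by (simp add: served_demand_add served_demand_scaleR)
  qed
  ultimately show ?thesis
    unfolding Omega_eq by (intro convex_Int convex_box)
qed

section \<open>Continuity and monotonicity of the game map\<close>

lemma Omega_unit: "x \<in> Omega S t \<Longrightarrow> 0 \<le> x $ i \<and> x $ i \<le> 1"
  by (simp add: Omega_iff_jointly_feasible jointly_feasible_def)

text \<open>A player's utility depends only on its own strategy, so the map is separable. The bound
  2 keeps the logarithm differentiable.\<close>

lemma F_map_nth:
  assumes "x $ i < 2"
  shows "F_map S t x $ i = m_veh S t i *
    (2 * (m_veh S t i * x $ i - d_dem S t i) + alpha1 S / (2 - x $ i) - alpha2 S * price S t)"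
proof -
  have "((\<lambda>s. utility S t i (vec_upd x i s)) has_real_derivative
     - (m_veh S t i *
    (2 * (m_veh S t i * x $ i - d_dem S t i) + alpha1 S / (2 - x $ i) - alpha2 S * price S t))) (at (x $ i))"
    unfolding utility_def vec_upd_nth using assms
    by (auto intro!: derivative_eq_intros simp: field_simps)
  then show ?thesis
    by (simp add: F_map_def partial_deriv_def DERIV_imp_deriv)
qed

lemma continuous_on_F_map: "continuous_on (Omega S t) (F_map S t)"
proof -
  have lt: "x $ i < 2" if "x \<in> Omega S t" for x i
    using Omega_unit[OF that, of i] by simp
  have "continuous_on (Omega S t) (\<lambda>x. \<chi> i. m_veh S t i *
    (2 * (m_veh S t i * x $ i - d_dem S t i) + alpha1 S / (2 - x $ i) - alpha2 S * price S t))"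
    by (intro continuous_intros ballI) (use lt in \<open>simp add: less_imp_neq[THEN not_sym]\<close>)
  then show ?thesis
    by (rule continuous_on_eq) (simp add: vec_eq_iff F_map_nth lt)
qed

text \<open>The left side is the exact contribution of the quadratic term; the logarithmic term adds
  a nonnegative amount, since \<open>1 / (2 - s)\<close> increases for \<open>s < 2\<close>, and the
  price term cancels.\<close>

lemma F_map_nth_mono:
  assumes "x \<in> Omega S t" "y \<in> Omega S t" "alpha1 S \<ge> 0" "m_veh S t i \<ge> 0"
  shows "2 * (m_veh S t i * (x $ i - y $ i))\<^sup>2 \<le> (F_map S t x $ i - F_map S t y $ i) * (x $ i - y $ i)"
proof -
  let ?m = "m_veh S t i" and ?a = "x $ i" and ?b = "y $ i"
  have lt: "?a < 2" "?b < 2" using Omega_unit[OF assms(1), of i] Omega_unit[OF assms(2), of i] by auto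
  have "1 / (2 - ?a) - 1 / (2 - ?b) = (?a - ?b) / ((2 - ?a) * (2 - ?b))"
    using lt by (simp add: field_simps)
  then have "(1 / (2 - ?a) - 1 / (2 - ?b)) * (?a - ?b) = (?a - ?b)\<^sup>2 / ((2 - ?a) * (2 - ?b))"
    by (simp add: power2_eq_square)
  also have "\<dots> \<ge> 0" using lt by simp
  finally have "0 \<le> (?m * alpha1 S) * ((1 / (2 - ?a) - 1 / (2 - ?b)) * (?a - ?b))"
    by (rule mult_nonneg_nonneg[OF mult_nonneg_nonneg[OF assms(4,3)]])
  moreover have "(F_map S t x $ i - F_map S t y $ i) * (?a - ?b) = 2 * (?m * (?a - ?b))\<^sup>2
      + (?m * alpha1 S) * ((1 / (2 - ?a) - 1 / (2 - ?b)) * (?a - ?b))"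
    unfolding F_map_nth[of x i, OF lt(1)] F_map_nth[of y i, OF lt(2)]
    by (simp add: power2_eq_square algebra_simps)
  ultimately show ?thesis by linarith
qed

lemma inner_F_map_diff_ge:
  assumes "x \<in> Omega S t" "y \<in> Omega S t" "alpha1 S \<ge> 0" "\<And>i. m_veh S t i \<ge> 0"
  shows "(\<Sum>i\<in>UNIV. 2 * (m_veh S t i * (x $ i - y $ i))\<^sup>2) \<le> (F_map S t x - F_map S t y) \<bullet> (x - y)"
  using F_map_nth_mono[OF assms] by (simp add: inner_vec_def sum_mono)

lemma monotone_F_map:
  assumes "alpha1 S \<ge> 0" "\<And>i. m_veh S t i \<ge> 0"
  shows "monotone_operator_on (Omega S t) (F_map S t)"
  unfolding monotone_operator_on_def
proof (intro ballI)
  fix x y assume "x \<in> Omega S t" "y \<in> Omega S t"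
  from inner_F_map_diff_ge[OF this assms] show "(F_map S t x - F_map S t y) \<bullet> (x - y) \<ge> 0"
    by (rule order_trans[rotated]) (simp add: sum_nonneg)
qed

text \<open>Adding the two VIs bounds the monotonicity gap by 0, while the quadratic terms keep it
  positive unless the profiles agree wherever there are vehicles.\<close>

lemma VI_solution_unique:
  assumes "alpha1 S \<ge> 0" "\<And>i. m_veh S t i \<ge> 0"
    and "VI_solution (F_map S t) (Omega S t) x" "VI_solution (F_map S t) (Omega S t) y" "m_veh S t i > 0"
  shows "x $ i = y $ i"
proof -
  have xy: "x \<in> Omega S t" "y \<in> Omega S t" using assms by (auto simp: VI_solution_def)
  have "F_map S t x \<bullet> (y - x) \<ge> 0" "F_map S t y \<bullet> (x - y) \<ge> 0"
    using assms xy by (auto simp: VI_solution_def)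
  then have "(F_map S t x - F_map S t y) \<bullet> (x - y) \<le> 0"
    by (simp add: inner_diff_left inner_diff_right)
  then have "(\<Sum>i\<in>UNIV. 2 * (m_veh S t i * (x $ i - y $ i))\<^sup>2) \<le> 0"
    using inner_F_map_diff_ge[OF xy assms(1,2)] by linarith
  then have "(\<Sum>i\<in>UNIV. 2 * (m_veh S t i * (x $ i - y $ i))\<^sup>2) = 0"
    by (simp add: antisym sum_nonneg)
  then have "2 * (m_veh S t i * (x $ i - y $ i))\<^sup>2 = 0"
    by (subst (asm) sum_nonneg_eq_0_iff) auto
  then show ?thesis using assms(5) by simp
qed

section \<open>Constraint gradients; equilibria solve the VI\<close>

lemma sum_cstr:
  fixes g :: "'i::finite cstr \<Rightarrow> real"
  shows "(\<Sum>c\<in>UNIV. g c) = g Charge_le + g Charge_ge + g Demand + (\<Sum>j\<in>UNIV. g (Upper j)) + (\<Sum>j\<in>UNIV. g (Lower j))"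
proof -
  have UN: "(UNIV :: 'i cstr set) = {Charge_le, Charge_ge, Demand} \<union> (range Upper \<union> range Lower)"
  proof (rule UNIV_eq_I)
    fix c :: "'i cstr"
    show "c \<in> {Charge_le, Charge_ge, Demand} \<union> (range Upper \<union> range Lower)" by (cases c) simp_all
  qed
  have "(\<Sum>c\<in>UNIV. g c) = sum g {Charge_le, Charge_ge, Demand} + (sum g (range Upper) + sum g (range Lower))"
    unfolding UN by (subst sum.union_disjoint; (subst sum.union_disjoint)?) auto
  also have "sum g (range Upper) = (\<Sum>j\<in>UNIV. g (Upper j))"
    by (subst sum.reindex) (auto simp: inj_on_def)
  also have "sum g (range Lower) = (\<Sum>j\<in>UNIV. g (Lower j))"
    by (subst sum.reindex) (auto simp: inj_on_def)
  finally show ?thesis by simp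
qed

fun theta_grad :: "('i::finite) jtcs \<Rightarrow> nat \<Rightarrow> 'i cstr \<Rightarrow> 'i \<Rightarrow> real" where
  "theta_grad S t Charge_le i = - r_charge S * m_veh S t i"
| "theta_grad S t Charge_ge i = r_charge S * m_veh S t i"
| "theta_grad S t Demand i = - m_veh S t i"
| "theta_grad S t (Upper j) i = (if j = i then 1 else 0)"
| "theta_grad S t (Lower j) i = (if j = i then - 1 else 0)"

lemma partial_deriv_theta: "partial_deriv i (theta S t c) x = theta_grad S t c i"
proof -
  have "((\<lambda>s. theta S t c (vec_upd x i s)) has_real_derivative theta_grad S t c i) (at (x $ i))"
    by (cases c) (auto simp: charged_energy_eq served_demand_vec_upd vec_upd_nth
        intro!: derivative_eq_intros)
  then show ?thesis by (simp add: partial_deriv_def DERIV_imp_deriv)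
qed

text \<open>The constraints are affine, so the first-order expansion is exact.\<close>

lemma theta_affine: "theta S t c y - theta S t c x = (\<Sum>i\<in>UNIV. theta_grad S t c i * (y $ i - x $ i))"
proof -
  have served: "(\<Sum>i\<in>UNIV. m_veh S t i * (y $ i - x $ i)) = served_demand S t y - served_demand S t x"
    unfolding served_demand_diff[symmetric] by (simp add: served_demand_def)
  have grad: "(\<Sum>i\<in>UNIV. (a * m_veh S t i) * (y $ i - x $ i)) = a * (served_demand S t y - served_demand S t x)" for a
    unfolding mult.assoc sum_distrib_left[symmetric] served ..
  show ?thesis
  proof (cases c)
    case Charge_le
    then show ?thesis using grad[of "- r_charge S"] by (simp add: charged_energy_eq right_diff_distrib)
  next
    case Charge_ge
    then show ?thesis using grad[of "r_charge S"] by (simp add: charged_energy_eq right_diff_distrib)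
  next
    case Demand
    then show ?thesis using grad[of "- 1"] by simp
  qed (simp_all add: if_distrib[of "\<lambda>a. a * _"] del: minus_diff_eq cong: if_cong)
qed

text \<open>Stationarity makes \<open>F\<close> minus a multiplier combination of constraint
  gradients. By affinity and complementary slackness, \<open>F \<bullet> (y - x)\<close> is then
  minus the weighted constraint values at \<open>y\<close>, which are nonpositive.\<close>

lemma NNE_imp_VI_solution:
  assumes "is_NNE S t x"
  shows "VI_solution (F_map S t) (Omega S t) x"
proof -
  from assms obtain \<mu> where x: "x \<in> Omega S t"
    and stat: "\<And>i. - partial_deriv i (utility S t i) x + (\<Sum>c\<in>UNIV. \<mu> c * partial_deriv i (theta S t c) x) = 0"
    and comp: "(\<Sum>c\<in>UNIV. \<mu> c * theta S t c x) = 0" and nonneg: "\<And>c. \<mu> c \<ge> 0"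
    unfolding normalized_Nash_def by blast
  have F: "F_map S t x $ i = - (\<Sum>c\<in>UNIV. \<mu> c * theta_grad S t c i)" for i
    using stat[of i] by (simp add: F_map_def partial_deriv_theta)
  have "F_map S t x \<bullet> (y - x) \<ge> 0" if y: "y \<in> Omega S t" for y
  proof -
    have le: "theta S t c y \<le> 0" for c
      using y by (cases c) (auto simp: Omega_iff_jointly_feasible jointly_feasible_def)
    have "F_map S t x \<bullet> (y - x) = - (\<Sum>i\<in>UNIV. \<Sum>c\<in>UNIV. \<mu> c * theta_grad S t c i * (y $ i - x $ i))"
      by (simp add: inner_vec_def F sum_distrib_right sum_negf)
    also have "\<dots> = - (\<Sum>c\<in>UNIV. \<mu> c * (theta S t c y - theta S t c x))"
      unfolding theta_affine by (subst sum.swap) (simp add: sum_distrib_left mult.assoc)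
    also have "\<dots> = - (\<Sum>c\<in>UNIV. \<mu> c * theta S t c y)"
      by (simp add: right_diff_distrib sum_subtractf comp)
    also have "\<dots> \<ge> 0"
      using nonneg le by (simp add: sum_nonpos mult_nonneg_nonpos)
    finally show ?thesis .
  qed
  then show ?thesis using x by (simp add: VI_solution_def)
qed

section \<open>Common multipliers for solutions of the VI\<close>

lemma VI_solution_direction:
  assumes "VI_solution (F_map S t) (Omega S t) x"
    and "r_charge S = 0 \<or> served_demand S t v = 0"
    and "served_demand S t x + served_demand S t v \<ge> d_tot S t"
    and "\<And>i. 0 \<le> x $ i + v $ i \<and> x $ i + v $ i \<le> 1"
  shows "F_map S t x \<bullet> v \<ge> 0"
proof -
  \<comment> \<open>The charging equation fixes the served demand if \<open>r_charge S\<close> is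
    nonzero; otherwise it does not involve the profile.\<close>
  have "x + v \<in> Omega S t"
    using assms by (auto simp: VI_solution_def Omega_iff_jointly_feasible jointly_feasible_def
        served_demand_add charged_energy_eq)
  then have "F_map S t x \<bullet> (x + v - x) \<ge> 0"
    using assms(1) unfolding VI_solution_def by blast
  then show ?thesis by simp
qed

text \<open>Supplies the dual variable from finitely many lower and upper bounds. Empty sets are
  treated apart, where \<open>Max\<close> and \<open>Min\<close> are unspecified.\<close>

lemma ex_between_finite:
  fixes A B :: "'a::linorder set"
  assumes "finite A" "finite B" "\<And>a b. a \<in> A \<Longrightarrow> b \<in> B \<Longrightarrow> a \<le> b"
  shows "\<exists>c. (\<forall>a\<in>A. a \<le> c) \<and> (\<forall>b\<in>B. c \<le> b)"
proof (cases "A = {}")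
  case True
  then show ?thesis using assms by (cases "B = {}") (auto intro: exI[of _ "Min B"])
next
  case False
  then show ?thesis using assms by (intro exI[of _ "Max A"]) auto
qed

text \<open>
  The dual variable of the coupling constraints. The reduced costs are compared by moving a small
  amount of transportation from player \<open>i\<close> to player \<open>j\<close>; the last two clauses, which concern
  \<open>r = 0\<close>, come from changing the strategy of a single player.
\<close>

lemma VI_solution_coupling_price:
  assumes sol: "VI_solution (F_map S t) (Omega S t) x" and m: "\<And>i. m_veh S t i \<ge> 0"
  shows "\<exists>\<kappa>. (\<forall>i. (x $ i > 0 \<longrightarrow> F_map S t x $ i \<le> \<kappa> * m_veh S t i) \<and>
                  (x $ i < 1 \<longrightarrow> \<kappa> * m_veh S t i \<le> F_map S t x $ i)) \<and>
             (r_charge S = 0 \<longrightarrow> \<kappa> \<ge> 0 \<and> \<kappa> * (d_tot S t - served_demand S t x) = 0)"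
proof -
  let ?m = "m_veh S t" and ?F = "F_map S t x" and ?r = "r_charge S"
  have x: "x \<in> Omega S t" using sol by (simp add: VI_solution_def)
  have unit: "0 \<le> x $ i" "x $ i \<le> 1" for i using Omega_unit[OF x] by auto
  have dem: "served_demand S t x \<ge> d_tot S t"
    using x by (simp add: Omega_iff_jointly_feasible jointly_feasible_def)
  define slack where "slack \<longleftrightarrow> ?r = 0 \<and> served_demand S t x > d_tot S t"
  \<comment> \<open>\<open>A\<close> collects lower bounds for \<kappa>, from players able to reduce
    transportation, and \<open>B\<close> upper bounds, from players able to increase it. For
    \<open>?r = 0\<close>, the 0 in \<open>A\<close> gives \<open>\<kappa> \<ge> 0\<close>, and
    under slack demand the 0 in \<open>B\<close> forces \<open>\<kappa> = 0\<close>.\<close>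
  define A where "A = (\<lambda>i. ?F $ i / ?m i) ` {i. ?m i > 0 \<and> x $ i > 0} \<union> (if ?r = 0 then {0} else {})"
  define B where "B = (\<lambda>i. ?F $ i / ?m i) ` {i. ?m i > 0 \<and> x $ i < 1} \<union> (if slack then {0} else {})"
  have inner: "?F \<bullet> axis i s = ?F $ i * s" for i s
    by (simp add: inner_axis)
  have exchange: "?F $ i / ?m i \<le> ?F $ j / ?m j"
    if *: "?m i > 0" "x $ i > 0" "?m j > 0" "x $ j < 1" for i j
  proof (cases "i = j")
    case False
    \<comment> \<open>The largest number of vehicles that can be shifted from \<open>i\<close> to
      \<open>j\<close> within the box; the served demand is unchanged.\<close>
    define \<epsilon> where "\<epsilon> = min (?m i * x $ i) (?m j * (1 - x $ j))"
    have \<epsilon>: "\<epsilon> > 0" "\<epsilon> / ?m i \<le> x $ i" "\<epsilon> / ?m j \<le> 1 - x $ j"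
      using * by (auto simp: \<epsilon>_def divide_le_eq mult.commute)
    moreover have "x $ i \<le> 1 + \<epsilon> / ?m i" "0 \<le> x $ j + \<epsilon> / ?m j"
      using * \<epsilon>(1) unit by (simp_all add: add_increasing2)
    ultimately have "?F \<bullet> (axis j (\<epsilon> / ?m j) - axis i (\<epsilon> / ?m i)) \<ge> 0"
      using * \<epsilon> dem unit False
      by (intro VI_solution_direction[OF sol])
        (auto simp: served_demand_diff served_demand_axis axis_component algebra_simps intro: order_trans)
    then have "\<epsilon> * (?F $ i / ?m i) \<le> \<epsilon> * (?F $ j / ?m j)"
      by (simp add: inner_diff_right inner mult.commute)
    then show ?thesis using \<epsilon>(1) by (simp only: mult_le_cancel_left_pos)
  qed simp
  have raise: "0 \<le> ?F $ j / ?m j" if *: "?r = 0" "?m j > 0" "x $ j < 1" for j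
  proof -
    \<comment> \<open>Raising the strategy of \<open>j\<close> to 1 only adds to the served
      demand.\<close>
    have "d_tot S t \<le> served_demand S t x + ?m j * (1 - x $ j)"
      using * dem by (intro add_increasing2) simp_all
    then have "?F \<bullet> axis j (1 - x $ j) \<ge> 0"
      using * dem unit
      by (intro VI_solution_direction[OF sol]) (auto simp: served_demand_axis axis_component)
    then show ?thesis using * by (simp add: inner zero_le_mult_iff)
  qed
  have lower: "?F $ i / ?m i \<le> 0" if *: slack "?m i > 0" "x $ i > 0" for i
  proof -
    \<comment> \<open>The largest decrease of player \<open>i\<close> that keeps its strategy
      nonnegative and the demand served.\<close>
    define \<epsilon> where "\<epsilon> = min (x $ i) ((served_demand S t x - d_tot S t) / ?m i)"
    have \<epsilon>: "\<epsilon> > 0" "\<epsilon> \<le> x $ i" "?m i * \<epsilon> \<le> served_demand S t x - d_tot S t"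
      using * by (auto simp: \<epsilon>_def slack_def min_def field_simps)
    moreover have "x $ i - \<epsilon> \<le> 1" using unit(2)[of i] \<epsilon>(1) by linarith
    ultimately have "?F \<bullet> axis i (- \<epsilon>) \<ge> 0"
      using * dem unit
      by (intro VI_solution_direction[OF sol])
        (auto simp: served_demand_axis axis_component slack_def intro: order_trans)
    then have "?F $ i \<le> 0" using \<epsilon>(1) by (simp add: inner mult_le_0_iff)
    then show ?thesis using * by (simp add: divide_le_0_iff)
  qed
  have "finite A" "finite B" by (auto simp: A_def B_def)
  moreover have "a \<le> b" if "a \<in> A" "b \<in> B" for a b
    using that exchange raise lower by (auto simp: A_def B_def split: if_splits)
  ultimately obtain \<kappa> where \<kappa>: "\<And>a. a \<in> A \<Longrightarrow> a \<le> \<kappa>" "\<And>b. b \<in> B \<Longrightarrow> \<kappa> \<le> b"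
    using ex_between_finite[of A B] by blast
  have "?F $ i \<le> \<kappa> * ?m i" if "x $ i > 0" for i
  proof (cases "?m i = 0")
    \<comment> \<open>Without vehicles, both sides are 0.\<close>
    case True
    then show ?thesis using F_map_nth[of x i S t] unit[of i] by simp
  next
    case False
    then have "?m i > 0" using m[of i] by simp
    then show ?thesis using \<kappa>(1)[of "?F $ i / ?m i"] that by (simp add: A_def divide_le_eq)
  qed
  moreover have "\<kappa> * ?m i \<le> ?F $ i" if "x $ i < 1" for i
  proof (cases "?m i = 0")
    case True
    then show ?thesis using F_map_nth[of x i S t] unit[of i] by simp
  next
    case False
    then have "?m i > 0" using m[of i] by simp
    then show ?thesis using \<kappa>(2)[of "?F $ i / ?m i"] that by (simp add: B_def le_divide_eq)
  qed
  moreover have "\<kappa> \<ge> 0 \<and> \<kappa> * (d_tot S t - served_demand S t x) = 0" if "?r = 0"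
  proof (cases slack)
    case True
    then show ?thesis using \<kappa>(1)[of 0] \<kappa>(2)[of 0] that by (simp add: A_def B_def)
  next
    case False
    then show ?thesis using \<kappa>(1)[of 0] dem that by (simp add: A_def slack_def)
  qed
  ultimately show ?thesis by blast
qed

lemma VI_solution_imp_NNE:
  assumes sol: "VI_solution (F_map S t) (Omega S t) x" and m: "\<And>i. m_veh S t i \<ge> 0"
  shows "is_NNE S t x"
proof -
  let ?m = "m_veh S t" and ?F = "F_map S t x" and ?r = "r_charge S"
  have x: "x \<in> Omega S t" using sol by (simp add: VI_solution_def)
  have unit: "0 \<le> x $ i" "x $ i \<le> 1" for i using Omega_unit[OF x] by auto
  have charge: "charged_energy S t x = E_plus S t"
    using x by (simp add: Omega_iff_jointly_feasible jointly_feasible_def)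
  obtain \<kappa> where \<kappa>: "\<And>i. x $ i > 0 \<Longrightarrow> ?F $ i \<le> \<kappa> * ?m i" "\<And>i. x $ i < 1 \<Longrightarrow> \<kappa> * ?m i \<le> ?F $ i"
      "?r = 0 \<Longrightarrow> \<kappa> \<ge> 0 \<and> \<kappa> * (d_tot S t - served_demand S t x) = 0"
    using VI_solution_coupling_price[OF assms] by blast
  \<comment> \<open>For nonzero \<open>?r\<close> the charging equation carries \<kappa>, with
    \<open>\<kappa> / ?r\<close> split by sign over its two inequalities. For \<open>?r = 0\<close>
    division by zero makes these multipliers 0, and the demand constraint carries \<kappa>. The box
    multipliers are the positive and negative parts of the remaining reduced cost.\<close>
  define \<mu> where "\<mu> = (\<lambda>c. case c of
      Charge_le \<Rightarrow> max (\<kappa> / ?r) 0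
    | Charge_ge \<Rightarrow> max (- (\<kappa> / ?r)) 0
    | Demand \<Rightarrow> if ?r = 0 then \<kappa> else 0
    | Upper i \<Rightarrow> max (\<kappa> * ?m i - ?F $ i) 0
    | Lower i \<Rightarrow> max (?F $ i - \<kappa> * ?m i) 0)"
  have "- partial_deriv i (utility S t i) x + (\<Sum>c\<in>UNIV. \<mu> c * partial_deriv i (theta S t c) x) = 0" for i
  proof -
    have "(\<Sum>c\<in>UNIV. \<mu> c * theta_grad S t c i) =
        - (max (\<kappa> / ?r) 0 - max (- (\<kappa> / ?r)) 0) * ?r * ?m i - (if ?r = 0 then \<kappa> else 0) * ?m i
        + (max (\<kappa> * ?m i - ?F $ i) 0 - max (?F $ i - \<kappa> * ?m i) 0)"
      by (simp add: sum_cstr \<mu>_def if_distrib[of "(*) _"] cong: if_cong) (simp add: algebra_simps)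
    also have "\<dots> = - ?F $ i" by (auto simp: max_def)
    finally show ?thesis by (simp add: partial_deriv_theta F_map_def)
  qed
  moreover have "(\<Sum>c\<in>UNIV. \<mu> c * theta S t c x) = 0"
  proof -
    have "\<mu> (Upper i) * theta S t (Upper i) x = 0" for i
      using \<kappa>(2)[of i] unit(2)[of i] by (cases "x $ i = 1") (simp_all add: \<mu>_def)
    moreover have "\<mu> (Lower i) * theta S t (Lower i) x = 0" for i
      using \<kappa>(1)[of i] unit(1)[of i] by (cases "x $ i = 0") (simp_all add: \<mu>_def)
    moreover have "\<mu> Demand * theta S t Demand x = 0"
      using \<kappa>(3) by (simp add: \<mu>_def)
    moreover have "theta S t Charge_le x = 0" "theta S t Charge_ge x = 0"
      using charge by simp_all
    ultimately show ?thesis by (simp only: sum_cstr mult_zero_right sum.neutral_const add_0)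
  qed
  moreover have "\<mu> c \<ge> 0" for c using \<kappa>(3) by (cases c) (auto simp: \<mu>_def)
  moreover have "theta S t c x \<le> 0" for c
    using x by (cases c) (auto simp: Omega_iff_jointly_feasible jointly_feasible_def)
  ultimately show ?thesis unfolding normalized_Nash_def using x by blast
qed

text \<open>At a fixed positive tolerance the output is only approximate, so its convergence is
  stated for the tolerance tending to 0 from the right. Uniqueness is asserted where there are
  vehicles: with \<open>m_veh S t i = 0\<close> the strategy of \<open>i\<close> affects only its
  box constraints.\<close>

theorem mainTheorem4:
  fixes S :: "('i::finite) jtcs" and t :: nat
  assumes "jtcs_run S" and "t < T_slots S"
  shows
    "closed (Omega S t) \<and> convex (Omega S t) \<and>
     continuous_on (Omega S t) (F_map S t) \<and> monotone_operator_on (Omega S t) (F_map S t) \<and>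
     (\<forall>x. VI_solution (F_map S t) (Omega S t) x \<longleftrightarrow> is_NNE S t x) \<and>
     (\<forall>x y. is_NNE S t x \<and> is_NNE S t y \<longrightarrow> (\<forall>i. m_veh S t i > 0 \<longrightarrow> x $ i = y $ i)) \<and>
     sspm_well_defined (sspm S) (F_map S t) (Omega S t) (x_init S t) \<and>
     (\<forall>\<epsilon>>0. \<exists>k. jtcs_stops_at S t \<epsilon> k) \<and>
     (\<exists>xs. VI_solution (F_map S t) (Omega S t) xs \<and> is_NNE S t xs \<and>
        jtcs_iterate S t \<longlonglongrightarrow> xs \<and>
        (jtcs_strategy S t \<longlongrightarrow> xs) (at_right 0))"
proof -
  have \<alpha>: "alpha1 S \<ge> 0" using assms by (simp add: jtcs_run_def)
  have m: "m_veh S t i \<ge> 0" for i using assms by (simp add: jtcs_run_def m_veh_def)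
  have init: "x_init S t \<in> Omega S t" using assms by (simp add: jtcs_run_def)
  interpret sspm_run "F_map S t" "Omega S t" "sspm S" "x_init S t"
    using assms init
    by unfold_locales
      (auto simp: jtcs_run_def compact_Omega convex_Omega continuous_on_F_map monotone_F_map[OF \<alpha> m])
  have equiv: "VI_solution (F_map S t) (Omega S t) x \<longleftrightarrow> is_NNE S t x" for x
    using VI_solution_imp_NNE[OF _ m] NNE_imp_VI_solution by blast
  obtain xs where "VI_solution (F_map S t) (Omega S t) xs" "jtcs_iterate S t \<longlonglongrightarrow> xs"
    using converges by blast
  moreover from this have "(jtcs_strategy S t \<longlongrightarrow> xs) (at_right 0)"
    by (intro output_tendsto)
  ultimately have "\<exists>xs. VI_solution (F_map S t) (Omega S t) xs \<and> is_NNE S t xs \<and>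
      jtcs_iterate S t \<longlonglongrightarrow> xs \<and> (jtcs_strategy S t \<longlongrightarrow> xs) (at_right 0)"
    using equiv by blast
  moreover have "x $ i = y $ i" if "is_NNE S t x" "is_NNE S t y" "m_veh S t i > 0" for x y i
    using that VI_solution_unique[OF \<alpha> m] unfolding equiv[symmetric] by blast
  ultimately show ?thesis
    using closed convex cont mono well_defined stops equiv by blast
qed

end
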